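(* Let $b(x)$ (for $x>-\frac12$) be the remainder and $w(x)=12x\,b(x)$ the variant remainder of Burnside's formula, i.e. $\Gamma(x+1)=\sqrt{2\pi}\,\bigl(\frac{x+1/2}{e}\bigr)^{x+1/2}e^{b(x)}$ and $\Gamma(x+1)=\sqrt{2\pi}\,\bigl(\frac{x+1/2}{e}\bigr)^{x+1/2}e^{w(x)/(12x)}$ (expressions with $w(x)/(12x)$ being read for $x\neq 0$). Then all of the following hold. (1) For $x>-\frac12$, $$b(x)=\frac{w(x)}{12x}=\int_0^\infty\biggl(1-\frac{e^t}{2t}+\frac{1}{e^{2t}-1}\biggr)\frac1t\,e^{-2(x+1)t}\,dt,$$ and the function $-b(x)=-\frac{w(x)}{12x}$ is completely monotonic on $\bigl(-\frac12,\infty\bigr)$. (2) For $x>0$, $$x b(x)+\frac1{24}=\frac1{12}\biggl[w(x)+\frac12\biggr]=\frac14\int_0^\infty\frac{f_1(t)}{t^3(e^{2t}-1)^2}e^{-(2x+1)t}\,dt,$$ and this function is completely monotonic on $(0,\infty)$, where $$f_1(t)=(t+2)e^{4t}-2t(2t+1)e^{3t}-2(t+2)e^{2t}+2te^t+t+2$$ is absolutely monotonic on $(0,\infty)$. (3) For $x>0$, $$\frac16-\frac{x}3-8x^2b(x)=\frac23\biggl[\frac14-\frac{x}2-xw(x)\biggr]=\int_0^\infty\frac{f_2(t)}{t^4(e^{2t}-1)^3}e^{-(2x+1)t}\,dt,$$ and this function is completely monotonic on $(0,\infty)$, where $$\begin{aligned}f_2(t)&=(t^2+4t+6)e^{6t}-4t(2t^2+2t+1)e^{5t}-3(t^2+4t+6)e^{4t}\\&\quad-8t(t^2-t-1)e^{3t}+3(t^2+4t+6)e^{2t}-4te^t-t^2-4t-6\end{aligned}$$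 is absolutely monotonic on $(0,\infty)$. (4) For $x>0$, $$16x^3b(x)+\frac23x^2-\frac13x+\frac{23}{180}=\frac43\biggl[x^2w(x)+\frac12x^2-\frac14x+\frac{23}{240}\biggr]=\int_0^\infty\frac{f_3(t)}{t^5(e^{2t}-1)^4}e^{-(2x+1)t}\,dt,$$ and this function is completely monotonic on $(0,\infty)$, where $$\begin{aligned}f_3(t)&=(t^3+6t^2+18t+24)e^{8t}-4t(4t^3+6t^2+6t+3)e^{7t}\\&\quad-4(t^3+6t^2+18t+24)e^{6t}-4t(16t^3-12t-9)e^{5t}\\&\quad+6(t^3+6t^2+18t+24)e^{4t}-4t(4t^3-6t^2+6t+9)e^{3t}\\&\quad-4(t^3+6t^2+18t+24)e^{2t}+12te^t+t^3+6t^2+18t+24\end{aligned}$$ is absolutely monotonic on $(0,\infty)$. (5) For $x>-\frac12$, $$(2x+1)b(x)+\frac1{12}=\int_0^\infty\frac{h_1(t)}{(e^{2t}-1)^2t^3}e^{-(2x+1)t}\,dt,$$ and this function is completely monotonic on $\bigl(-\frac12,\infty\bigr)$, where $$h_1(t)=e^{4t}-t(t+1)e^{3t}-2e^{2t}-t(t-1)e^t+1$$ is absolutely monotonic on $(0,\infty)$. (6) For $x>-\frac12$, $$-(x+1)b(x)-\frac1{24}=\frac14\int_0^\infty\frac{h_2(t)}{t^3(e^{2t}-1)^2}e^{-(2x+1)t}\,dt,$$ and this function is completely monotonic on $\bigl(-\frac12,\infty\bigr)$, where $$h_2(t)=e^{4t}(t-2)+2e^{3t}t-2e^{2t}(t-2)+2e^tt(2t-1)+t-2$$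 is absolutely monotonic on $(0,\infty)$. (7) For $x>-\frac12$, $$-(x+1)^2b(x)-\frac1{24}x-\frac1{16}=\frac18\int_0^\infty\frac{h_3(t)}{(e^{2t}-1)^3t^4}e^{-(2x+1)t}\,dt,$$ and this function is completely monotonic on $\bigl(-\frac12,\infty\bigr)$, where $$\begin{aligned}h_3(t)&=e^{6t}(t^2-4t+6)-4e^{5t}t-3e^{4t}(t^2-4t+6)-8e^{3t}(t^2+t-1)t\\&\quad+3e^{2t}(t^2-4t+6)-4e^t(2t^2-2t+1)t-t^2+4t-6\end{aligned}$$ is absolutely monotonic on $(0,\infty)$. (8) For $x>-\frac12$, $$-(x+1)^3b(x)-\frac{x^2}{24}-\frac{5x}{48}-\frac{203}{2880}=\frac1{16}\int_0^\infty\frac{h_4(t)}{(e^{2t}-1)^4t^5}e^{-(2x+1)t}\,dt,$$ and this function is completely monotonic on $\bigl(-\frac12,\infty\bigr)$, where $$\begin{aligned}h_4(t)&=e^{8t}(t^3-6t^2+18t-24)+12e^{7t}t-4e^{6t}(t^3-6t^2+18t-24)\\&\quad+4e^{5t}(4t^3+6t^2+6t-9)t+6e^{4t}(t^3-6t^2+18t-24)\\&\quad+4e^{3t}(16t^3-12t+9)t-4e^{2t}(t^3-6t^2+18t-24)\\&\quad+4e^t(4t^3-6t^2+6t-3)t+t^3-6t^2+18t-24\end{aligned}$$ is absolutely monotonic on $(0,\infty)$.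
   Context: $\Gamma$ is Euler's gamma function. Explicitly, for $x>-\frac12$, $b(x)=\ln\Gamma(x+1)-\frac12\ln(2\pi)-\bigl(x+\frac12\bigr)\ln\bigl(x+\frac12\bigr)+x+\frac12$ and $w(x)=12x\,b(x)$. A function $f$ is completely monotonic on an interval $I$ if $f$ has derivatives of all orders on $I$ and $(-1)^nf^{(n)}(x)\ge0$ for all $x\in I$ and all integers $n\ge0$. A function $f$ is absolutely monotonic on an interval $I$ if $f$ has derivatives of all orders on $I$ and $f^{(n)}(x)\ge0$ for all $x\in I$ and all integers $n\ge0$. *)

theory Defs
  imports "HOL-Analysis.Analysis"
begin

section \<open>Complete and absolute monotonicity\<close>

text \<open>
  \<open>D n\<close> is the \<open>n\<close>-th derivative of \<open>f\<close> on \<open>I\<close>.  Derivatives are taken within \<open>I\<close>, hence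
  one-sided at endpoints belonging to \<open>I\<close>; on an interval with more than one point they are
  unique, and on an open one they are the ordinary derivatives (see the lemmas below).
\<close>

definition has_derivs_on :: "(real \<Rightarrow> real) \<Rightarrow> (nat \<Rightarrow> real \<Rightarrow> real) \<Rightarrow> real set \<Rightarrow> bool" where
  "has_derivs_on f D I \<longleftrightarrow>
     (\<forall>x\<in>I. D 0 x = f x) \<and>
     (\<forall>n. \<forall>x\<in>I. (D n has_real_derivative D (Suc n) x) (at x within I))"

definition completely_monotonic_on :: "real set \<Rightarrow> (real \<Rightarrow> real) \<Rightarrow> bool" where
  "completely_monotonic_on I f \<longleftrightarrow>
     (\<exists>D. has_derivs_on f D I \<and> (\<forall>n. \<forall>x\<in>I. 0 \<le> (-1) ^ n * D n x))"

definition absolutely_monotonic_on :: "real set \<Rightarrow> (real \<Rightarrow> real) \<Rightarrow> bool" where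
  "absolutely_monotonic_on I f \<longleftrightarrow>
     (\<exists>D. has_derivs_on f D I \<and> (\<forall>n. \<forall>x\<in>I. 0 \<le> D n x))"

lemma has_derivs_on_open_eq:
  assumes "open I" "has_derivs_on f D I" "x \<in> I"
  shows "D n x = (deriv ^^ n) f x"
  using assms(3)
proof (induction n arbitrary: x)
  case 0
  then show ?case using assms(2) by (simp add: has_derivs_on_def)
next
  case (Suc n)
  have "(D n has_real_derivative D (Suc n) x) (at x)"
    using assms Suc.prems by (metis has_derivs_on_def at_within_open)
  then have "((deriv ^^ n) f has_real_derivative D (Suc n) x) (at x)"
    by (rule has_field_derivative_transform_within_open[OF _ assms(1) Suc.prems]) (rule Suc.IH)
  then show ?case by (simp add: DERIV_imp_deriv)
qed

lemma has_derivs_on_open_iff: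
  assumes "open I"
  shows "(\<exists>D. has_derivs_on f D I \<and> (\<forall>n. \<forall>x\<in>I. P n (D n x))) \<longleftrightarrow>
    (\<forall>n. \<forall>x\<in>I. (deriv ^^ n) f differentiable (at x) \<and> P n ((deriv ^^ n) f x))"
    (is "?L \<longleftrightarrow> ?R")
proof
  assume ?L
  then obtain D where D: "has_derivs_on f D I" "\<And>n x. x \<in> I \<Longrightarrow> P n (D n x)" by blast
  note eq = has_derivs_on_open_eq[OF assms D(1)]
  have "(deriv ^^ n) f differentiable (at x)" if "x \<in> I" for n x
  proof -
    have "(D n has_real_derivative D (Suc n) x) (at x)"
      using assms D(1) that by (metis has_derivs_on_def at_within_open)
    then have "((deriv ^^ n) f has_real_derivative D (Suc n) x) (at x)"
      by (rule has_field_derivative_transform_within_open[OF _ assms that]) (rule eq)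
    then show ?thesis by (auto simp: real_differentiable_def)
  qed
  then show ?R using D(2) eq by metis
next
  assume R: ?R
  have "has_derivs_on f (\<lambda>n. (deriv ^^ n) f) I"
    unfolding has_derivs_on_def
  proof (intro conjI allI ballI)
    fix n x assume "x \<in> I"
    then have "(deriv ^^ n) f differentiable (at x)" using R by blast
    then have "((deriv ^^ n) f has_real_derivative deriv ((deriv ^^ n) f) x) (at x)"
      by (auto simp: real_differentiable_def dest: DERIV_imp_deriv)
    then show "((deriv ^^ n) f has_real_derivative (deriv ^^ Suc n) f x) (at x within I)"
      by (simp add: has_field_derivative_at_within)
  qed simp
  then show ?L using R by blast
qed

lemma completely_monotonic_on_open_iff:
  assumes "open I"
  shows "completely_monotonic_on I f \<longleftrightarrow>
    (\<forall>n. \<forall>x\<in>I. (deriv ^^ n) f differentiable (at x) \<and> 0 \<le> (-1) ^ n * (deriv ^^ n) f x)"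
  unfolding completely_monotonic_on_def
  by (rule has_derivs_on_open_iff[OF assms, where P = "\<lambda>n y. 0 \<le> (-1) ^ n * y"])

lemma absolutely_monotonic_on_open_iff:
  assumes "open I"
  shows "absolutely_monotonic_on I f \<longleftrightarrow>
    (\<forall>n. \<forall>x\<in>I. (deriv ^^ n) f differentiable (at x) \<and> 0 \<le> (deriv ^^ n) f x)"
  unfolding absolutely_monotonic_on_def
  by (rule has_derivs_on_open_iff[OF assms, where P = "\<lambda>n y. 0 \<le> y"])


section \<open>The remainder and the variant remainder of Burnside's formula\<close>

text \<open>Both functions are meaningful only for \<open>x > -1/2\<close>.\<close>

definition burnside_b :: "real \<Rightarrow> real" where
  "burnside_b x =
     ln (Gamma (x + 1)) - 1/2 * ln (2 * pi) - (x + 1/2) * ln (x + 1/2) + x + 1/2"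

definition burnside_w :: "real \<Rightarrow> real" where
  "burnside_w x = 12 * x * burnside_b x"

lemma Gamma_burnside_iff:
  fixes x \<beta> :: real
  assumes "x > -1/2"
  shows "Gamma (x + 1) = sqrt (2 * pi) * ((x + 1/2) / exp 1) powr (x + 1/2) * exp \<beta>
           \<longleftrightarrow> \<beta> = burnside_b x"
proof -
  let ?R = "sqrt (2 * pi) * ((x + 1/2) / exp 1) powr (x + 1/2) * exp \<beta>"
  have pos: "Gamma (x + 1) > 0" using assms by (intro Gamma_real_pos) simp
  have x: "x + 1/2 > 0" using assms by simp
  have R: "?R > 0" using x by (simp add: powr_def)
  have "ln ?R = 1/2 * ln (2 * pi) + (x + 1/2) * (ln (x + 1/2) - 1) + \<beta>"
    using x by (simp add: ln_mult ln_sqrt ln_powr ln_div)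
  moreover have "Gamma (x + 1) = ?R \<longleftrightarrow> ln (Gamma (x + 1)) = ln ?R"
    using pos R by (simp only: ln_inj_iff)
  ultimately show ?thesis by (auto simp: burnside_b_def algebra_simps)
qed

lemma Gamma_burnside_w_iff:
  fixes x \<omega> :: real
  assumes "x > -1/2" "x \<noteq> 0"
  shows "Gamma (x + 1) = sqrt (2 * pi) * ((x + 1/2) / exp 1) powr (x + 1/2) * exp (\<omega> / (12 * x))
           \<longleftrightarrow> \<omega> = burnside_w x"
proof -
  have "\<omega> / (12 * x) = burnside_b x \<longleftrightarrow> \<omega> = burnside_w x"
    using assms(2) by (simp add: burnside_w_def divide_eq_eq mult_ac)
  then show ?thesis using Gamma_burnside_iff[OF assms(1)] by simp
qed


section \<open>The numerators of the integrands\<close>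

definition f1 :: "real \<Rightarrow> real" where
  "f1 t = (t + 2) * exp (4*t) - 2 * t * (2*t + 1) * exp (3*t) - 2 * (t + 2) * exp (2*t)
     + 2 * t * exp t + t + 2"

definition f2 :: "real \<Rightarrow> real" where
  "f2 t = (t^2 + 4*t + 6) * exp (6*t) - 4 * t * (2*t^2 + 2*t + 1) * exp (5*t)
     - 3 * (t^2 + 4*t + 6) * exp (4*t) - 8 * t * (t^2 - t - 1) * exp (3*t)
     + 3 * (t^2 + 4*t + 6) * exp (2*t) - 4 * t * exp t - t^2 - 4*t - 6"

definition f3 :: "real \<Rightarrow> real" where
  "f3 t = (t^3 + 6*t^2 + 18*t + 24) * exp (8*t)
     - 4 * t * (4*t^3 + 6*t^2 + 6*t + 3) * exp (7*t)
     - 4 * (t^3 + 6*t^2 + 18*t + 24) * exp (6*t)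
     - 4 * t * (16*t^3 - 12*t - 9) * exp (5*t)
     + 6 * (t^3 + 6*t^2 + 18*t + 24) * exp (4*t)
     - 4 * t * (4*t^3 - 6*t^2 + 6*t + 9) * exp (3*t)
     - 4 * (t^3 + 6*t^2 + 18*t + 24) * exp (2*t)
     + 12 * t * exp t + t^3 + 6*t^2 + 18*t + 24"

definition h1 :: "real \<Rightarrow> real" where
  "h1 t = exp (4*t) - t * (t + 1) * exp (3*t) - 2 * exp (2*t) - t * (t - 1) * exp t + 1"

definition h2 :: "real \<Rightarrow> real" where
  "h2 t = exp (4*t) * (t - 2) + 2 * exp (3*t) * t - 2 * exp (2*t) * (t - 2)
     + 2 * exp t * t * (2*t - 1) + t - 2"

definition h3 :: "real \<Rightarrow> real" where
  "h3 t = exp (6*t) * (t^2 - 4*t + 6) - 4 * exp (5*t) * t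
     - 3 * exp (4*t) * (t^2 - 4*t + 6) - 8 * exp (3*t) * (t^2 + t - 1) * t
     + 3 * exp (2*t) * (t^2 - 4*t + 6) - 4 * exp t * (2*t^2 - 2*t + 1) * t
     - t^2 + 4*t - 6"

text \<open>
  The factor \<open>t\<close> ending the \<open>exp (5*t)\<close> term is missing in the source, evidently by a misprint:
  without it \<open>h4 0 = -36\<close> and the integrals built from \<open>h4\<close> diverge at \<open>0\<close>.
\<close>

definition h4 :: "real \<Rightarrow> real" where
  "h4 t = exp (8*t) * (t^3 - 6*t^2 + 18*t - 24) + 12 * exp (7*t) * t
     - 4 * exp (6*t) * (t^3 - 6*t^2 + 18*t - 24)
     + 4 * exp (5*t) * (4*t^3 + 6*t^2 + 6*t - 9) * t
     + 6 * exp (4*t) * (t^3 - 6*t^2 + 18*t - 24)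
     + 4 * exp (3*t) * (16*t^3 - 12*t + 9) * t
     - 4 * exp (2*t) * (t^3 - 6*t^2 + 18*t - 24)
     + 4 * exp t * (4*t^3 - 6*t^2 + 6*t - 3) * t
     + t^3 - 6*t^2 + 18*t - 24"

end

theory Submission
  imports Defs "HOL-Real_Asymp.Real_Asymp"
begin

text \<open>
  Put \<open>s = 2 * x + 1\<close>, so that \<open>s > 0\<close> when \<open>x > -1/2\<close>, and write \<open>L g s\<close> for the Laplace transform
  of \<open>g\<close>.  Everything follows from one integral representation, \<open>b(x) = - L q s / 2\<close> with
  \<open>q(t) = 1 / t\<^sup>2 - 1 / (t * sinh t)\<close> (\<open>burnside_b_eq_laplace_quotient\<close>).

  Integration by parts gives \<open>s * L g s = g(0+) + L g' s\<close>.  Since \<open>2 * x = s - 1\<close> and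
  \<open>2 * (x + 1) = s + 1\<close>, multiplying the remainder by \<open>2 * x\<close>, by \<open>2 * x + 1\<close> or by \<open>2 * (x + 1)\<close>
  amounts to applying \<open>g \<mapsto> g' - g\<close>, \<open>g \<mapsto> g'\<close> or \<open>g \<mapsto> g' + g\<close> to the kernel and adding the boundary
  value \<open>g(0+)\<close> (\<open>laplace_shift\<close>).  The quotients with numerators \<open>f1\<close>, \<open>f2\<close>, \<open>f3\<close>, with numerator \<open>h1\<close>, and
  with numerators \<open>h2\<close>, \<open>h3\<close>, \<open>h4\<close> are, up to sign and a factor 2, what these three operations make of
  \<open>q\<close>; the polynomials in \<open>x\<close> that accompany the powers of \<open>x\<close> times \<open>b(x)\<close> collect the boundary
  values \<open>1/6\<close>, \<open>1/6\<close> and \<open>23/180\<close>.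

  A Laplace transform of a nonnegative function is completely monotonic, by differentiation under
  the integral sign (\<open>completely_monotonic_on_laplace\<close>), and the numerators are nonnegative as soon
  as they are absolutely monotonic.  For the latter, observe that \<open>f\<close> inherits absolute
  monotonicity from \<open>g = f' - m * f\<close> whenever \<open>m \<ge> 0\<close> and \<open>f 0 \<ge> 0\<close>: the derivatives obey
  \<open>f^(n+1) = m * f^(n) + g^(n)\<close>.  Passing from \<open>f\<close> to \<open>g\<close> lowers the degree of the polynomial in
  front of \<open>exp (m * t)\<close>, so finitely many such steps, with the exponents in increasing order,
  leave only a polynomial with nonnegative coefficients times the largest exponential
  (\<open>absolutely_monotonic_on_exp_poly\<close>).

  The representation of \<open>b\<close> itself rests on \<open>b(x + 1) - b(x)\<close> being elementary: its second derivative
  is the one that the integral predicts, and all the differences vanish at infinity, so that \<open>b\<close> and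
  the integral differ by a function of period 1.  The limit formula for \<open>\<Gamma>\<close> shows that this function
  is constant, and the duplication formula that the constant is 0.
\<close>

section \<open>Absolutely monotonic exponential polynomials\<close>

text \<open>
  Nonnegativity of \<open>f\<close> itself comes from \<open>(exp (- m * t) * f t)' = exp (- m * t) * g t \<ge> 0\<close>; the higher
  derivatives are then nonnegative by \<open>f^(n+1) = m * f^(n) + g^(n)\<close>.
\<close>

lemma absolutely_monotonic_on_linear_ODE:
  fixes f g :: "real \<Rightarrow> real"
  assumes deriv: "\<And>t. t \<ge> 0 \<Longrightarrow> (f has_real_derivative m * f t + g t) (at t)"
    and g: "absolutely_monotonic_on {0..} g" and f0: "f 0 \<ge> 0" and m: "m \<ge> 0"
  shows "absolutely_monotonic_on {0..} f"
proof -
  obtain G where "has_derivs_on g G {0..}" and "\<forall>n. \<forall>t\<in>{0..}. 0 \<le> G n t"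
    using g unfolding absolutely_monotonic_on_def by blast
  then have G0: "G 0 t = g t" and Gpos: "G n t \<ge> 0"
    and G: "(G n has_real_derivative G (Suc n) t) (at t within {0..})" if "t \<ge> 0" for n t
    using that by (simp_all add: has_derivs_on_def)
  define F where "F = rec_nat f (\<lambda>n Fn t. m * Fn t + G n t)"
  have F0: "F 0 = f" and FS: "\<And>n. F (Suc n) = (\<lambda>t. m * F n t + G n t)"
    by (simp_all add: F_def)
  have Fderiv: "(F n has_real_derivative F (Suc n) t) (at t within {0..})" if "t \<ge> 0" for n t
  proof (induction n)
    case 0
    show ?case using deriv[OF that] G0[OF that] by (simp add: F0 FS has_field_derivative_at_within)
  next
    case (Suc n)
    show ?case unfolding FS[of "Suc n"] unfolding FS[of n]
      by (rule derivative_eq_intros Suc.IH[unfolded FS] G that refl | simp)+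
  qed
  have fpos: "f t \<ge> 0" if t: "t \<ge> 0" for t
  proof -
    have d: "((\<lambda>t. exp (- m * t) * f t) has_real_derivative exp (- m * u) * g u) (at u)"
      if "u \<ge> 0" for u
      by (rule derivative_eq_intros deriv that refl | simp add: algebra_simps)+
    have p: "exp (- m * u) * g u \<ge> 0" if "u \<ge> 0" for u
      using Gpos[OF that, of 0] G0[OF that] by simp
    have "exp (- m * 0) * f 0 \<le> exp (- m * t) * f t"
      using t by (rule DERIV_nonneg_imp_nondecreasing) (blast intro: d p)
    then have "0 \<le> exp (- m * t) * f t" using f0 by simp
    then show ?thesis by (simp add: zero_le_mult_iff)
  qed
  have "F n t \<ge> 0" if "t \<ge> 0" for n t
    using that by (induction n) (auto simp: F0 FS fpos Gpos m)
  then show ?thesis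
    unfolding absolutely_monotonic_on_def has_derivs_on_def
    using Fderiv F0 by (intro exI[of _ F]) auto
qed

text \<open>
  An exponential polynomial \<open>\<Sum>k. p_k(t) * exp (k * t)\<close> is encoded by the list of the \<open>p_k\<close>, each given
  by its coefficient list, constant term first.  Evaluation is by Horner's scheme, in \<open>t\<close> and in
  \<open>exp t\<close>, so that the operator \<open>D + c\<close>, with \<open>D\<close> the derivative, acts by recursion on the lists: it
  maps \<open>a + t * p\<close> to \<open>p + (c * a + t * (D + c) p)\<close> and \<open>p + exp t * P\<close> to
  \<open>(D + c) p + exp t * (D + c + 1) P\<close>.
\<close>

fun coeffs_add :: "int list \<Rightarrow> int list \<Rightarrow> int list" where
  "coeffs_add [] q = q"
| "coeffs_add p [] = p"
| "coeffs_add (a # p) (b # q) = (a + b) # coeffs_add p q"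

fun poly_shift_deriv :: "int \<Rightarrow> int list \<Rightarrow> int list" where
  "poly_shift_deriv c [] = []"
| "poly_shift_deriv c (a # p) = coeffs_add p (c * a # poly_shift_deriv c p)"

fun exp_poly_shift_deriv :: "int \<Rightarrow> int list list \<Rightarrow> int list list" where
  "exp_poly_shift_deriv c [] = []"
| "exp_poly_shift_deriv c (p # P) = poly_shift_deriv c p # exp_poly_shift_deriv (c + 1) P"

fun poly_val :: "int list \<Rightarrow> real \<Rightarrow> real" where
  "poly_val [] t = 0"
| "poly_val (a # p) t = of_int a + t * poly_val p t"

fun exp_poly :: "int list list \<Rightarrow> real \<Rightarrow> real" where
  "exp_poly [] t = 0"
| "exp_poly (p # P) t = poly_val p t + exp t * exp_poly P t"

fun exp_poly_at_0 :: "int list list \<Rightarrow> int" where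
  "exp_poly_at_0 [] = 0"
| "exp_poly_at_0 ([] # P) = exp_poly_at_0 P"
| "exp_poly_at_0 ((a # p) # P) = a + exp_poly_at_0 P"

text \<open>
  The list \<open>[m1, m2, ...]\<close> of nonnegative integers certifies absolute monotonicity of \<open>P\<close> if the exponential polynomials \<open>P\<close>,
  \<open>(D - m1) P\<close>, \<open>(D - m2) (D - m1) P\<close>, ... are nonnegative at 0 and the last one has nonnegative
  coefficients.
\<close>

fun am_certificate :: "int list \<Rightarrow> int list list \<Rightarrow> bool" where
  "am_certificate [] P \<longleftrightarrow> list_all (list_all (\<lambda>a. a \<ge> 0)) P"
| "am_certificate (m # ms) P \<longleftrightarrow>
     m \<ge> 0 \<and> exp_poly_at_0 P \<ge> 0 \<and> am_certificate ms (exp_poly_shift_deriv (- m) P)"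

lemma poly_val_coeffs_add: "poly_val (coeffs_add p q) t = poly_val p t + poly_val q t"
  by (induction p q rule: coeffs_add.induct) (auto simp: algebra_simps)

lemma poly_val_deriv:
  "(poly_val p has_real_derivative poly_val (poly_shift_deriv c p) t - c * poly_val p t) (at t within S)"
proof (induction p)
  case Nil
  have "poly_val [] = (\<lambda>t. 0)" by auto
  then show ?case by simp
next
  case (Cons a p)
  have "poly_val (a # p) = (\<lambda>t. of_int a + t * poly_val p t)" by auto
  moreover have "((\<lambda>t. of_int a + t * poly_val p t) has_real_derivative
      poly_val (poly_shift_deriv c (a # p)) t - c * poly_val (a # p) t) (at t within S)"
    by (rule derivative_eq_intros Cons refl | simp add: poly_val_coeffs_add algebra_simps)+
  ultimately show ?case by simp
qed

lemma exp_poly_deriv: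
  "(exp_poly P has_real_derivative exp_poly (exp_poly_shift_deriv c P) t - c * exp_poly P t) (at t within S)"
proof (induction P arbitrary: c)
  case (Cons p P)
  have "exp_poly (p # P) = (\<lambda>t. poly_val p t + exp t * exp_poly P t)" by auto
  moreover have "((\<lambda>t. poly_val p t + exp t * exp_poly P t) has_real_derivative
      exp_poly (exp_poly_shift_deriv c (p # P)) t - c * exp_poly (p # P) t) (at t within S)"
    by (rule derivative_eq_intros poly_val_deriv[of _ c] Cons[of "c+1"] refl | simp add: algebra_simps)+
  ultimately show ?case by simp
next
  case Nil
  have "exp_poly [] = (\<lambda>t. 0)" by auto
  then show ?case by simp
qed

lemma exp_poly_at_0: "exp_poly P 0 = of_int (exp_poly_at_0 P)"
  by (induction P rule: exp_poly_at_0.induct) auto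

lemma coeffs_add_nonneg:
  "list_all (\<lambda>a. a \<ge> 0) p \<Longrightarrow> list_all (\<lambda>a. a \<ge> 0) q \<Longrightarrow> list_all (\<lambda>a. a \<ge> 0) (coeffs_add p q)"
  by (induction p q rule: coeffs_add.induct) auto

lemma poly_shift_deriv_nonneg:
  "c \<ge> 0 \<Longrightarrow> list_all (\<lambda>a. a \<ge> 0) p \<Longrightarrow> list_all (\<lambda>a. a \<ge> 0) (poly_shift_deriv c p)"
  by (induction p) (auto intro!: coeffs_add_nonneg)

lemma exp_poly_shift_deriv_nonneg:
  "c \<ge> 0 \<Longrightarrow> list_all (list_all (\<lambda>a. a \<ge> 0)) P \<Longrightarrow>
    list_all (list_all (\<lambda>a. a \<ge> 0)) (exp_poly_shift_deriv c P)"
  by (induction P arbitrary: c) (auto intro!: poly_shift_deriv_nonneg)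

lemma poly_val_nonneg: "t \<ge> 0 \<Longrightarrow> list_all (\<lambda>a. a \<ge> 0) p \<Longrightarrow> poly_val p t \<ge> 0"
  by (induction p) auto

lemma exp_poly_nonneg: "t \<ge> 0 \<Longrightarrow> list_all (list_all (\<lambda>a. a \<ge> 0)) P \<Longrightarrow> exp_poly P t \<ge> 0"
  by (induction P) (auto intro!: add_nonneg_nonneg poly_val_nonneg)

lemma absolutely_monotonic_on_exp_poly_nonneg_coeffs:
  assumes "list_all (list_all (\<lambda>a. a \<ge> 0)) P"
  shows "absolutely_monotonic_on {0..} (exp_poly P)"
proof -
  have nonneg: "list_all (list_all (\<lambda>a. a \<ge> 0)) ((exp_poly_shift_deriv 0 ^^ n) P)" for n
    using assms by (induction n) (auto intro!: exp_poly_shift_deriv_nonneg)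
  have "(exp_poly ((exp_poly_shift_deriv 0 ^^ n) P) has_real_derivative
      exp_poly ((exp_poly_shift_deriv 0 ^^ Suc n) P) t) (at t within {0..})" for n t
    using exp_poly_deriv[of "(exp_poly_shift_deriv 0 ^^ n) P" 0 t "{0..}"] by simp
  then show ?thesis
    unfolding absolutely_monotonic_on_def has_derivs_on_def
    using nonneg by (intro exI[of _ "\<lambda>n. exp_poly ((exp_poly_shift_deriv 0 ^^ n) P)"])
      (auto intro!: exp_poly_nonneg)
qed

lemma absolutely_monotonic_on_exp_poly:
  "am_certificate ms P \<Longrightarrow> absolutely_monotonic_on {0..} (exp_poly P)"
proof (induction ms arbitrary: P)
  case Nil
  then show ?case by (simp add: absolutely_monotonic_on_exp_poly_nonneg_coeffs)
next
  case (Cons m ms)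
  show ?case
  proof (rule absolutely_monotonic_on_linear_ODE)
    show "(exp_poly P has_real_derivative
        of_int m * exp_poly P t + exp_poly (exp_poly_shift_deriv (- m) P) t) (at t)" for t
      using exp_poly_deriv[of P "- m" t UNIV] by (simp add: add.commute)
    show "absolutely_monotonic_on {0..} (exp_poly (exp_poly_shift_deriv (- m) P))"
      using Cons.prems by (intro Cons.IH) simp
    show "exp_poly P 0 \<ge> 0" using Cons.prems unfolding exp_poly_at_0 by simp
    show "0 \<le> real_of_int m" using Cons.prems by simp
  qed
qed

lemma absolutely_monotonic_on_subset:
  assumes f: "absolutely_monotonic_on S f" and "T \<subseteq> S"
  shows "absolutely_monotonic_on T f"
proof -
  obtain D where D: "has_derivs_on f D S" "\<forall>n. \<forall>t\<in>S. 0 \<le> D n t"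
    using f unfolding absolutely_monotonic_on_def by blast
  have "has_derivs_on f D T"
    unfolding has_derivs_on_def
  proof (intro conjI allI ballI)
    fix n t assume "t \<in> T"
    then have "(D n has_real_derivative D (Suc n) t) (at t within S)"
      using D(1) \<open>T \<subseteq> S\<close> unfolding has_derivs_on_def by blast
    then show "(D n has_real_derivative D (Suc n) t) (at t within T)"
      using \<open>T \<subseteq> S\<close> by (rule has_field_derivative_subset)
  qed (use D(1) \<open>T \<subseteq> S\<close> in \<open>auto simp: has_derivs_on_def\<close>)
  then show ?thesis
    using D(2) \<open>T \<subseteq> S\<close> unfolding absolutely_monotonic_on_def by blast
qed

lemma absolutely_monotonic_on_pos_exp_poly:
  "am_certificate ms P \<Longrightarrow> absolutely_monotonic_on {0<..} (exp_poly P)"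
  by (rule absolutely_monotonic_on_subset[OF absolutely_monotonic_on_exp_poly]) auto

lemma absolutely_monotonic_on_imp_nonneg:
  assumes "absolutely_monotonic_on S f" "t \<in> S"
  shows "f t \<ge> 0"
proof -
  obtain D where D: "has_derivs_on f D S" "\<forall>n. \<forall>t\<in>S. 0 \<le> D n t"
    using assms(1) unfolding absolutely_monotonic_on_def by blast
  then have "D 0 t = f t" "0 \<le> D 0 t" using assms(2) unfolding has_derivs_on_def by blast+
  then show ?thesis by simp
qed

lemma exp_numeral_times: "exp (numeral k * t :: real) = exp t ^ numeral k"
  using exp_of_nat_mult[of "numeral k" t] by simp

section \<open>The numerators are absolutely monotonic\<close>

text \<open>
  The numerator of \<open>1 / t\<^sup>2 - 1 / (t * sinh t) = f0 t / (t\<^sup>2 * (exp (2*t) - 1))\<close>, the kernel that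
  represents \<open>- 2 * b\<close>.
\<close>

definition f0 :: "real \<Rightarrow> real" where
  "f0 t = exp (2*t) - 2 * t * exp t - 1"

definition f0_coeffs :: "int list list" where
  "f0_coeffs = [[-1], [0, -2], [1]]"

definition f1_coeffs :: "int list list" where
  "f1_coeffs = [[2, 1], [0, 2], [-4, -2], [0, -2, -4], [2, 1]]"

definition f2_coeffs :: "int list list" where
  "f2_coeffs = [[-6, -4, -1], [0, -4], [18, 12, 3], [0, 8, 8, -8], [-18, -12, -3],
     [0, -4, -8, -8], [6, 4, 1]]"

definition f3_coeffs :: "int list list" where
  "f3_coeffs = [[24, 18, 6, 1], [0, 12], [-96, -72, -24, -4], [0, -36, -24, 24, -16],
     [144, 108, 36, 6], [0, 36, 48, 0, -64], [-96, -72, -24, -4],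
     [0, -12, -24, -24, -16], [24, 18, 6, 1]]"

definition h1_coeffs :: "int list list" where
  "h1_coeffs = [[1], [0, 1, -1], [-2], [0, -1, -1], [1]]"

definition h2_coeffs :: "int list list" where
  "h2_coeffs = [[-2, 1], [0, -2, 4], [4, -2], [0, 2], [-2, 1]]"

definition h3_coeffs :: "int list list" where
  "h3_coeffs = [[-6, 4, -1], [0, -4, 8, -8], [18, -12, 3], [0, 8, -8, -8], [-18, 12, -3], [0, -4],
     [6, -4, 1]]"

definition h4_coeffs :: "int list list" where
  "h4_coeffs = [[-24, 18, -6, 1], [0, -12, 24, -24, 16], [96, -72, 24, -4], [0, 36, -48, 0, 64],
     [-144, 108, -36, 6], [0, -36, 24, 24, 16], [96, -72, 24, -4], [0, 12],
     [-24, 18, -6, 1]]"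

lemma f0_eq_exp_poly: "f0 = exp_poly f0_coeffs"
  by (rule ext, unfold f0_def f0_coeffs_def exp_numeral_times)
    (simp add: algebra_simps power_numeral_reduce)

lemma f1_eq_exp_poly: "f1 = exp_poly f1_coeffs"
  by (rule ext, unfold f1_def f1_coeffs_def exp_numeral_times)
    (simp add: algebra_simps power_numeral_reduce)

lemma f2_eq_exp_poly: "f2 = exp_poly f2_coeffs"
  by (rule ext, unfold f2_def f2_coeffs_def exp_numeral_times)
    (simp add: algebra_simps power_numeral_reduce)

lemma f3_eq_exp_poly: "f3 = exp_poly f3_coeffs"
  by (rule ext, unfold f3_def f3_coeffs_def exp_numeral_times)
    (simp add: algebra_simps power_numeral_reduce)

lemma h1_eq_exp_poly: "h1 = exp_poly h1_coeffs"
  by (rule ext, unfold h1_def h1_coeffs_def exp_numeral_times)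
    (simp add: algebra_simps power_numeral_reduce)

lemma h2_eq_exp_poly: "h2 = exp_poly h2_coeffs"
  by (rule ext, unfold h2_def h2_coeffs_def exp_numeral_times)
    (simp add: algebra_simps power_numeral_reduce)

lemma h3_eq_exp_poly: "h3 = exp_poly h3_coeffs"
  by (rule ext, unfold h3_def h3_coeffs_def exp_numeral_times)
    (simp add: algebra_simps power_numeral_reduce)

lemma h4_eq_exp_poly: "h4 = exp_poly h4_coeffs"
  by (rule ext, unfold h4_def h4_coeffs_def exp_numeral_times)
    (simp add: algebra_simps power_numeral_reduce)

text \<open>
  Applying \<open>D - k\<close> once more than the degree of the polynomial in front of \<open>exp (k * t)\<close> removes that
  exponential.  The certificates do this for all exponents but the largest one, in increasing order.
\<close>

lemma absolutely_monotonic_f0: "absolutely_monotonic_on {0<..} f0"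
  unfolding f0_eq_exp_poly
  by (rule absolutely_monotonic_on_pos_exp_poly[of
      "[0, 1, 1]"])
    (simp add: f0_coeffs_def)

lemma absolutely_monotonic_f1: "absolutely_monotonic_on {0<..} f1"
  unfolding f1_eq_exp_poly
  by (rule absolutely_monotonic_on_pos_exp_poly[of
      "[0, 0, 1, 1, 2, 2, 3, 3, 3]"])
    (simp add: f1_coeffs_def)

lemma absolutely_monotonic_f2: "absolutely_monotonic_on {0<..} f2"
  unfolding f2_eq_exp_poly
  by (rule absolutely_monotonic_on_pos_exp_poly[of
      "[0, 0, 0, 1, 1, 2, 2, 2, 3, 3, 3, 3, 4, 4, 4, 5, 5, 5, 5]"])
    (simp add: f2_coeffs_def)

lemma absolutely_monotonic_f3: "absolutely_monotonic_on {0<..} f3"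
  unfolding f3_eq_exp_poly
  by (rule absolutely_monotonic_on_pos_exp_poly[of
      "[0, 0, 0, 0, 1, 1, 2, 2, 2, 2, 3, 3, 3, 3, 3, 4, 4, 4, 4, 5, 5, 5, 5, 5, 6, 6, 6,
      6, 7, 7, 7, 7, 7]"])
    (simp add: f3_coeffs_def)

lemma absolutely_monotonic_h1: "absolutely_monotonic_on {0<..} h1"
  unfolding h1_eq_exp_poly
  by (rule absolutely_monotonic_on_pos_exp_poly[of
      "[0, 1, 1, 1, 2, 3, 3, 3]"])
    (simp add: h1_coeffs_def)

lemma absolutely_monotonic_h2: "absolutely_monotonic_on {0<..} h2"
  unfolding h2_eq_exp_poly
  by (rule absolutely_monotonic_on_pos_exp_poly[of
      "[0, 0, 1, 1, 1, 2, 2, 3, 3]"])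
    (simp add: h2_coeffs_def)

lemma absolutely_monotonic_h3: "absolutely_monotonic_on {0<..} h3"
  unfolding h3_eq_exp_poly
  by (rule absolutely_monotonic_on_pos_exp_poly[of
      "[0, 0, 0, 1, 1, 1, 1, 2, 2, 2, 3, 3, 3, 3, 4, 4, 4, 5, 5]"])
    (simp add: h3_coeffs_def)

lemma absolutely_monotonic_h4: "absolutely_monotonic_on {0<..} h4"
  unfolding h4_eq_exp_poly
  by (rule absolutely_monotonic_on_pos_exp_poly[of
      "[0, 0, 0, 0, 1, 1, 1, 1, 1, 2, 2, 2, 2, 3, 3, 3, 3, 3, 4, 4, 4, 4, 5, 5, 5, 5, 5,
      6, 6, 6, 6, 7, 7]"])
    (simp add: h4_coeffs_def)

section \<open>Laplace transforms and complete monotonicity\<close>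

text \<open>
  Continuity provides the measurability that comparison with an integrable function requires.
  Absolute integrability for every \<open>s > 0\<close>, rather than a bound on \<open>g\<close>, is a condition that
  multiplication by \<open>t\<close> preserves, so that a transform can be differentiated any number of times.
\<close>

definition laplace_transformable :: "(real \<Rightarrow> real) \<Rightarrow> bool" where
  "laplace_transformable g \<longleftrightarrow> continuous_on {0<..} g \<and>
     (\<forall>s>0. set_integrable lborel {0<..} (\<lambda>t. g t * exp (- s * t)))"

definition laplace :: "(real \<Rightarrow> real) \<Rightarrow> real \<Rightarrow> real" where
  "laplace g s = integral {0<..} (\<lambda>t. g t * exp (- s * t))"

lemma set_integrable_dominated:
  fixes f h :: "real \<Rightarrow> real"
  assumes "set_integrable lborel {0<..} h" "continuous_on {0<..} f"
    "\<And>t. t > 0 \<Longrightarrow> \<bar>f t\<bar> \<le> \<bar>h t\<bar>"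
  shows "set_integrable lborel {0<..} f"
proof (rule set_integrable_bound[OF assms(1)])
  show "set_borel_measurable lborel {0<..} f"
    using set_measurable_continuous_on[OF _ assms(2)] by (simp add: set_borel_measurable_def)
qed (use assms(3) in auto)

lemma laplace_transformable_integrable:
  assumes "laplace_transformable g" "s > 0"
  shows "(\<lambda>t. g t * exp (- s * t)) integrable_on {0<..}"
  using assms set_borel_integral_eq_integral(1) unfolding laplace_transformable_def by blast

text \<open>
  Half of the exponential decay is spent on \<open>t \<le> 2 / s * exp (s / 2 * t)\<close>.
\<close>

lemma laplace_transformable_times:
  assumes "laplace_transformable g"
  shows "laplace_transformable (\<lambda>t. t * g t)"
  unfolding laplace_transformable_def
proof (intro conjI allI impI)
  show cont: "continuous_on {0<..} (\<lambda>t. t * g t)"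
    using assms unfolding laplace_transformable_def by (intro continuous_intros) auto
  fix s :: real assume s: "s > 0"
  have int: "set_integrable lborel {0<..} (\<lambda>t. 2 / s * (g t * exp (- (s/2) * t)))"
    using assms s unfolding laplace_transformable_def
    by (intro set_integrable_mult_right) (metis half_gt_zero)
  show "set_integrable lborel {0<..} (\<lambda>t. t * g t * exp (- s * t))"
  proof (rule set_integrable_dominated[OF int])
    show "continuous_on {0<..} (\<lambda>t. t * g t * exp (- s * t))"
      by (intro continuous_intros cont)
    fix t :: real assume t: "t > 0"
    have "s * t \<le> 2 * exp (s * t / 2)" using exp_ge_add_one_self[of "s * t / 2"] by linarith
    then have "t * exp (- s * t) \<le> 2/s * exp (s/2*t) * exp (- s * t)"
      using s by (intro mult_right_mono) (simp_all add: field_simps)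
    also have "\<dots> = 2/s * exp (- (s/2) * t)"
      using exp_add[of "s/2*t" "- s*t", symmetric] by (simp add: mult.assoc field_simps)
    finally have "t * exp (- s * t) * \<bar>g t\<bar> \<le> 2/s * exp (- (s/2) * t) * \<bar>g t\<bar>"
      by (rule mult_right_mono) simp
    then show "\<bar>t * g t * exp (- s * t)\<bar> \<le> \<bar>2 / s * (g t * exp (- (s/2) * t))\<bar>"
      using s t by (simp add: abs_mult mult_ac)
  qed
qed

lemma laplace_transformable_power_times:
  "laplace_transformable g \<Longrightarrow> laplace_transformable (\<lambda>t. t ^ n * g t)"
  by (induction n) (auto dest: laplace_transformable_times simp: mult.assoc)

lemma has_integral_exp_minus: "s > 0 \<Longrightarrow> ((\<lambda>t. exp (- s * t)) has_integral 1 / s) {0<..}" for s :: real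
  using has_integral_exp_minus_to_infinity[of s 0]
  by (simp add: has_integral_closure[of "{0<..}", symmetric, unfolded closure_greaterThan])

lemma laplace_transformable_bounded:
  assumes cont: "continuous_on {0<..} g" and bound: "\<And>t. t > 0 \<Longrightarrow> \<bar>g t\<bar> \<le> C"
  shows "laplace_transformable g"
  unfolding laplace_transformable_def
proof (intro conjI allI impI cont)
  fix s :: real assume s: "s > 0"
  have "set_integrable lebesgue {0<..} (\<lambda>t. exp (- s * t))"
    using has_integral_exp_minus[OF s]
    by (intro nonnegative_absolutely_integrable_1) (auto simp: integrable_on_def)
  moreover have "(\<lambda>t. indicator {0<..} t *\<^sub>R exp (- s * t)) \<in> borel_measurable lborel"
    by measurable
  ultimately have "set_integrable lborel {0<..} (\<lambda>t. exp (- s * t))"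
    unfolding set_integrable_def by (simp add: integrable_completion)
  then have "set_integrable lborel {0<..} (\<lambda>t. C * exp (- s * t))" by simp
  then show "set_integrable lborel {0<..} (\<lambda>t. g t * exp (- s * t))"
  proof (rule set_integrable_dominated)
    show "continuous_on {0<..} (\<lambda>t. g t * exp (- s * t))"
      by (intro continuous_intros cont)
    show "\<bar>g t * exp (- s * t)\<bar> \<le> \<bar>C * exp (- s * t)\<bar>" if "t > 0" for t
      using bound[OF that] by (simp add: abs_mult)
  qed
qed

lemma abs_laplace_le:
  assumes cont: "continuous_on {0<..} g" and bound: "\<And>t. t > 0 \<Longrightarrow> \<bar>g t\<bar> \<le> C" and s: "s > 0"
  shows "\<bar>laplace g s\<bar> \<le> C / s"
proof -
  have 1: "((\<lambda>t. C * exp (- s * t)) has_integral C * (1 / s)) {0<..}"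
    by (intro has_integral_mult_right has_integral_exp_minus s)
  have "norm (laplace g s) \<le> integral {0<..} (\<lambda>t. C * exp (- s * t))"
    unfolding laplace_def
  proof (rule integral_norm_bound_integral)
    show "(\<lambda>t. g t * exp (- s * t)) integrable_on {0<..}"
      by (intro laplace_transformable_integrable laplace_transformable_bounded[OF cont bound] s)
    show "(\<lambda>t. C * exp (- s * t)) integrable_on {0<..}" using 1 by blast
  qed (use bound in \<open>auto simp: abs_mult\<close>)
  then show ?thesis unfolding integral_unique[OF 1] by simp
qed

lemma abs_exp_remainder_le: "\<bar>exp x - 1 - x\<bar> \<le> x\<^sup>2 * exp \<bar>x\<bar>" for x :: real
proof -
  obtain u where u: "\<bar>u\<bar> \<le> \<bar>x\<bar>" "exp x = (\<Sum>m<2. (x ^ m) / fact m) + (exp u / fact 2) * x ^ 2"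
    using Maclaurin_exp_le[of x 2] by blast
  have "\<bar>exp x - 1 - x\<bar> = exp u / 2 * x\<^sup>2" using u(2) by (simp add: numeral_2_eq_2)
  also have "\<dots> \<le> exp \<bar>x\<bar> * x\<^sup>2"
  proof (intro mult_right_mono)
    have "exp u \<le> exp \<bar>x\<bar>" using u(1) by simp
    then show "exp u / 2 \<le> exp \<bar>x\<bar>" using exp_gt_zero[of u] by linarith
  qed simp
  finally show ?thesis by (simp add: mult.commute)
qed

text \<open>
  The increment of \<open>laplace g\<close> minus its linear part is the integral of
  \<open>g t * exp (- s * t) * (exp (- h * t) - 1 + h * t)\<close>, whose last factor is at most
  \<open>(h * t)\<^sup>2 * exp (\<bar>h\<bar> * t)\<close>.  For \<open>\<bar>h\<bar> < s / 2\<close> this makes the integral at most \<open>h\<^sup>2\<close> times a constant.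
\<close>

lemma laplace_has_real_derivative:
  assumes g: "laplace_transformable g" and s: "s > 0"
  shows "(laplace g has_real_derivative - laplace (\<lambda>t. t * g t) s) (at s)"
proof -
  define K where "K = integral {0<..} (\<lambda>t. t\<^sup>2 * \<bar>g t\<bar> * exp (- (s/2) * t))"
  have K: "(\<lambda>t. t\<^sup>2 * \<bar>g t\<bar> * exp (- (s/2) * t)) integrable_on {0<..}"
  proof -
    have "set_integrable lborel {0<..} (\<lambda>t. \<bar>t\<^sup>2 * g t * exp (- (s/2) * t)\<bar>)"
      using laplace_transformable_power_times[OF g, of 2] s
      unfolding laplace_transformable_def by (intro set_integrable_abs) (metis half_gt_zero)
    then show ?thesis
      using set_borel_integral_eq_integral(1) by (force simp: abs_mult)
  qed
  note int = laplace_transformable_integrable[OF g]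
    laplace_transformable_integrable[OF laplace_transformable_times[OF g]]
  have est: "\<bar>(laplace g (s + h) - laplace g s) / h - - laplace (\<lambda>t. t * g t) s\<bar> \<le> K * \<bar>h\<bar>"
    if h: "\<bar>h\<bar> < s / 2" "h \<noteq> 0" for h
  proof -
    have sh: "s + h > 0" using h s by linarith
    let ?r = "\<lambda>t. g t * exp (- (s + h) * t) - g t * exp (- s * t) + h * (t * g t * exp (- s * t))"
    have r: "(?r has_integral
        laplace g (s + h) - laplace g s + h * laplace (\<lambda>t. t * g t) s) {0<..}"
      unfolding laplace_def
      by (intro has_integral_add has_integral_diff has_integral_mult_right integrable_integral int s sh)
    have "norm (integral {0<..} ?r) \<le>
        integral {0<..} (\<lambda>t. h\<^sup>2 * (t\<^sup>2 * \<bar>g t\<bar> * exp (- (s/2) * t)))"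
    proof (rule integral_norm_bound_integral)
      fix t :: real assume "t \<in> {0<..}"
      then have t: "t > 0" by simp
      have "?r t = (g t * exp (- s * t)) * (exp (- (h * t)) - 1 - - (h * t))"
        by (simp add: algebra_simps exp_add[symmetric])
      then have "norm (?r t) = \<bar>g t\<bar> * exp (- s * t) * \<bar>exp (- (h * t)) - 1 - - (h * t)\<bar>"
        by (simp add: abs_mult)
      also have "\<dots> \<le> \<bar>g t\<bar> * exp (- s * t) * ((- (h * t))\<^sup>2 * exp \<bar>- (h * t)\<bar>)"
        by (intro mult_left_mono abs_exp_remainder_le) simp
      also have "\<dots> \<le> \<bar>g t\<bar> * exp (- s * t) * ((- (h * t))\<^sup>2 * exp (s / 2 * t))"
        using h t by (intro mult_left_mono) (auto simp: abs_mult)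
      also have "\<dots> = h\<^sup>2 * (t\<^sup>2 * \<bar>g t\<bar> * (exp (- s * t) * exp (s / 2 * t)))"
        by (simp add: power_mult_distrib)
      also have "exp (- s * t) * exp (s / 2 * t) = exp (- (s/2) * t)"
        by (simp add: exp_add[symmetric])
      finally show "norm (?r t) \<le> h\<^sup>2 * (t\<^sup>2 * \<bar>g t\<bar> * exp (- (s/2) * t))" .
    qed (use r K in blast, use K in \<open>intro integrable_on_mult_right\<close>)
    also have "\<dots> = h\<^sup>2 * K" unfolding K_def by simp
    finally have "\<bar>laplace g (s + h) - laplace g s + h * laplace (\<lambda>t. t * g t) s\<bar> \<le> h\<^sup>2 * K"
      using r by (simp add: integral_unique)
    then have "\<bar>laplace g (s + h) - laplace g s + h * laplace (\<lambda>t. t * g t) s\<bar> / \<bar>h\<bar> \<le> h\<^sup>2 * K / \<bar>h\<bar>"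
      by (rule divide_right_mono) simp
    also have "h\<^sup>2 * K / \<bar>h\<bar> = K * \<bar>h\<bar>"
      using h(2) by (simp add: power2_eq_square abs_if)
    also have "\<bar>laplace g (s + h) - laplace g s + h * laplace (\<lambda>t. t * g t) s\<bar> / \<bar>h\<bar> =
        \<bar>(laplace g (s + h) - laplace g s) / h - - laplace (\<lambda>t. t * g t) s\<bar>"
      using h(2) by (simp add: abs_divide[symmetric] add_divide_distrib diff_divide_distrib)
    finally show ?thesis .
  qed
  have ev: "\<forall>\<^sub>F h in at 0. norm ((laplace g (s + h) - laplace g s) / h - - laplace (\<lambda>t. t * g t) s) \<le> K * \<bar>h\<bar>"
    unfolding eventually_at using est s by (intro exI[of _ "s / 2"]) (auto simp: dist_real_def)
  have "((\<lambda>h::real. K * \<bar>h\<bar>) \<longlongrightarrow> 0) (at 0)" by (auto intro!: tendsto_eq_intros)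
  then have "((\<lambda>h. (laplace g (s + h) - laplace g s) / h - - laplace (\<lambda>t. t * g t) s) \<longlongrightarrow> 0) (at 0)"
    by (rule Lim_null_comparison[OF ev])
  then show ?thesis unfolding DERIV_def by (rule LIM_zero_cancel)
qed

text \<open>
  This is the fundamental theorem of calculus for \<open>g t * exp (- s * t)\<close> on the positive half-line.
\<close>

lemma laplace_parts:
  assumes g: "laplace_transformable g" and g': "laplace_transformable g'"
    and deriv: "\<And>t. t > 0 \<Longrightarrow> (g has_real_derivative g' t) (at t)"
    and lim0: "(g \<longlongrightarrow> L) (at_right 0)" and lim_top: "(g \<longlongrightarrow> 0) at_top" and s: "s > 0"
  shows "s * laplace g s = L + laplace g' s"
proof -
  let ?F = "\<lambda>t. g t * exp (- s * t)"
  let ?f = "\<lambda>t. g' t * exp (- s * t) - s * (g t * exp (- s * t))"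
  have cont: "continuous_on {0<..} ?f"
    using g g' unfolding laplace_transformable_def by (intro continuous_intros) auto
  have int: "set_integrable lborel {0<..} ?f"
    using g g' s unfolding laplace_transformable_def
    by (intro set_integral_diff set_integrable_mult_right) auto
  have exp_top: "((\<lambda>t. exp (- s * t)) \<longlongrightarrow> 0) at_top"
    using s by real_asymp
  have exp_0: "((\<lambda>t. exp (- s * t)) \<longlongrightarrow> 1) (at_right 0)"
    by (auto intro!: tendsto_eq_intros)
  have "(LBINT t=0..\<infinity>. ?f t) = 0 - L"
  proof (rule interval_integral_FTC_integrable[where F = ?F])
    fix t :: real assume "0 < ereal t"
    then have t: "t > 0" by (simp add: zero_ereal_def)
    show "(?F has_vector_derivative ?f t) (at t)"
      unfolding has_real_derivative_iff_has_vector_derivative[symmetric]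
      by (rule derivative_eq_intros deriv[OF t] refl | simp add: algebra_simps)+
    show "isCont ?f t"
      using cont t continuous_on_eq_continuous_at open_greaterThan by blast
  next
    show "((?F \<circ> real_of_ereal) \<longlongrightarrow> L) (at_right 0)"
      unfolding zero_ereal_def ereal_tendsto_simps1
      using tendsto_mult[OF lim0 exp_0] by simp
    show "((?F \<circ> real_of_ereal) \<longlongrightarrow> 0) (at_left \<infinity>)"
      unfolding ereal_tendsto_simps1 using tendsto_mult[OF lim_top exp_top] by simp
  qed (use int in \<open>simp_all add: zero_ereal_def\<close>)
  then have "integral {0<..} ?f = - L"
    using set_borel_integral_eq_integral(2)[OF int] by (simp add: interval_lebesgue_integral_0_infty)
  moreover have "integral {0<..} ?f = laplace g' s - s * laplace g s"
    unfolding laplace_def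
    by (intro integral_unique has_integral_diff has_integral_mult_right integrable_integral
        laplace_transformable_integrable g g' s)
  ultimately show ?thesis by simp
qed

text \<open>
  The \<open>n\<close>-th derivative of \<open>laplace g (2 * x + 1)\<close> is \<open>(- 2) ^ n * laplace (\<lambda>t. t ^ n * g t) (2 * x + 1)\<close>.
\<close>

lemma completely_monotonic_on_laplace:
  assumes g: "laplace_transformable g" and nonneg: "\<And>t. t > 0 \<Longrightarrow> g t \<ge> 0"
    and I: "I \<subseteq> {-1/2<..}" and c: "c \<ge> 0"
    and F: "\<And>x. x \<in> I \<Longrightarrow> F x = c * laplace g (2 * x + 1)"
  shows "completely_monotonic_on I F"
proof -
  define D where "D n x = c * ((- 2) ^ n * laplace (\<lambda>t. t ^ n * g t) (2 * x + 1))" for n x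
  have "has_derivs_on F D I"
    unfolding has_derivs_on_def
  proof (intro conjI allI ballI)
    fix x assume "x \<in> I"
    then show "D 0 x = F x" using F by (simp add: D_def)
  next
    fix n x assume "x \<in> I"
    then have x: "2 * x + 1 > 0" using I by auto
    have "(laplace (\<lambda>t. t ^ n * g t) has_real_derivative
        - laplace (\<lambda>t. t ^ Suc n * g t) (2 * x + 1)) (at (2 * x + 1))"
      using laplace_has_real_derivative[OF laplace_transformable_power_times[OF g] x, of n]
      by (simp add: mult.assoc)
    then have "((\<lambda>x. laplace (\<lambda>t. t ^ n * g t) (2 * x + 1)) has_real_derivative
        - laplace (\<lambda>t. t ^ Suc n * g t) (2 * x + 1) * 2) (at x within I)"
      by (rule DERIV_chain2[where f = "laplace (\<lambda>t. t ^ n * g t)" and g = "\<lambda>x. 2 * x + 1"])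
        (auto intro!: derivative_eq_intros)
    then show "(D n has_real_derivative D (Suc n) x) (at x within I)"
      unfolding D_def by (auto intro!: derivative_eq_intros simp: algebra_simps)
  qed
  moreover have "0 \<le> (- 1) ^ n * D n x" if "x \<in> I" for n x
  proof -
    have x: "2 * x + 1 > 0" using I that by auto
    have "0 \<le> laplace (\<lambda>t. t ^ n * g t) (2 * x + 1)"
      unfolding laplace_def
      by (rule Henstock_Kurzweil_Integration.integral_nonneg[OF laplace_transformable_integrable[OF
              laplace_transformable_power_times[OF g] x]])
        (simp add: nonneg)
    moreover have "(- 1) ^ n * (- 2) ^ n = (2::real) ^ n"
      by (simp flip: power_mult_distrib)
    ultimately have "0 \<le> c * (((- 1) ^ n * (- 2) ^ n) * laplace (\<lambda>t. t ^ n * g t) (2 * x + 1))"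
      using c by simp
    also have "\<dots> = (- 1) ^ n * D n x"
      by (simp only: D_def mult_ac)
    finally show ?thesis .
  qed
  ultimately show ?thesis unfolding completely_monotonic_on_def by blast
qed

lemma bounded_on_positive_reals:
  fixes g :: "real \<Rightarrow> real"
  assumes cont: "continuous_on {0<..} g"
    and lim0: "(g \<longlongrightarrow> L) (at_right 0)" and lim_top: "(g \<longlongrightarrow> M) at_top"
  obtains C where "\<And>t. t > 0 \<Longrightarrow> \<bar>g t\<bar> \<le> C"
proof -
  have "\<forall>\<^sub>F t in at_right 0. \<bar>g t\<bar> < \<bar>L\<bar> + 1"
    by (rule order_tendstoD(2)[OF tendsto_rabs[OF lim0]]) simp
  then obtain a where a: "a > 0" "\<And>t. 0 < t \<Longrightarrow> t < a \<Longrightarrow> \<bar>g t\<bar> < \<bar>L\<bar> + 1"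
    unfolding eventually_at_right_field by auto
  have "\<forall>\<^sub>F t in at_top. \<bar>g t\<bar> < \<bar>M\<bar> + 1"
    by (rule order_tendstoD(2)[OF tendsto_rabs[OF lim_top]]) simp
  then obtain b where b: "\<And>t. t \<ge> b \<Longrightarrow> \<bar>g t\<bar> < \<bar>M\<bar> + 1"
    unfolding eventually_at_top_linorder by auto
  have "bounded (g ` {a..b})"
    using a(1) by (intro compact_imp_bounded compact_continuous_image continuous_on_subset[OF cont]) auto
  then obtain B where B: "\<forall>t\<in>{a..b}. \<bar>g t\<bar> \<le> B"
    unfolding bounded_iff by auto
  show thesis
  proof
    fix t :: real assume t: "t > 0"
    consider "t < a" | "a \<le> t \<and> t \<le> b" | "b \<le> t" by linarith
    then show "\<bar>g t\<bar> \<le> (\<bar>L\<bar> + 1) + (\<bar>M\<bar> + 1) + \<bar>B\<bar>"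
      by cases (use a(2)[OF t] b[of t] B[rule_format, of t] in auto)
  qed
qed

lemma laplace_transformable_if_limits:
  assumes "continuous_on {0<..} g" "(g \<longlongrightarrow> L) (at_right 0)" "(g \<longlongrightarrow> M) at_top"
  shows "laplace_transformable g"
  using bounded_on_positive_reals[OF assms] laplace_transformable_bounded[OF assms(1)] by metis

text \<open>
  Integration by parts for a function \<open>g\<close> with \<open>g' = c * g + d * h\<close>: multiplication of its transform
  by \<open>s - c\<close> replaces \<open>g\<close> by \<open>d * h\<close> and adds the boundary value.
\<close>

lemma laplace_shift:
  assumes g: "laplace_transformable g" and h: "laplace_transformable h"
    and deriv: "\<And>t. t > 0 \<Longrightarrow> (g has_real_derivative c * g t + d * h t) (at t)"
    and lim0: "(g \<longlongrightarrow> L) (at_right 0)" and lim_top: "(g \<longlongrightarrow> 0) at_top" and s: "s > 0"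
  shows "(s - c) * laplace g s = L + d * laplace h s"
proof -
  have int: "((\<lambda>t. (c * g t + d * h t) * exp (- u * t)) has_integral c * laplace g u + d * laplace h u) {0<..}"
    if "u > 0" for u
  proof -
    have "((\<lambda>t. c * (g t * exp (- u * t)) + d * (h t * exp (- u * t))) has_integral
        c * laplace g u + d * laplace h u) {0<..}"
      unfolding laplace_def
      by (intro has_integral_add has_integral_mult_right integrable_integral
          laplace_transformable_integrable g h that)
    then show ?thesis by (simp add: algebra_simps)
  qed
  have "laplace_transformable (\<lambda>t. c * g t + d * h t)"
    unfolding laplace_transformable_def
  proof (intro conjI allI impI)
    show "continuous_on {0<..} (\<lambda>t. c * g t + d * h t)"
      using g h unfolding laplace_transformable_def by (intro continuous_intros) auto
    show "set_integrable lborel {0<..} (\<lambda>t. (c * g t + d * h t) * exp (- u * t))" if "u > 0" for u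
    proof -
      have "set_integrable lborel {0<..} (\<lambda>t. c * (g t * exp (- u * t)) + d * (h t * exp (- u * t)))"
        using g h that unfolding laplace_transformable_def
        by (intro set_integral_add set_integrable_mult_right) auto
      then show ?thesis by (simp add: algebra_simps)
    qed
  qed
  from laplace_parts[OF g this deriv lim0 lim_top s]
  have "s * laplace g s = L + laplace (\<lambda>t. c * g t + d * h t) s" by simp
  also have "laplace (\<lambda>t. c * g t + d * h t) s = c * laplace g s + d * laplace h s"
    using int[OF s] unfolding laplace_def by (rule integral_unique)
  finally show ?thesis by (simp add: algebra_simps)
qed

section \<open>The remainder as a Laplace transform\<close>

lemma laplace_const: "s > 0 \<Longrightarrow> laplace (\<lambda>_. 1) s = 1 / s"
  using has_integral_exp_minus[of s] by (simp add: laplace_def integral_unique)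

lemma laplace_ident:
  assumes "s > 0"
  shows "laplace (\<lambda>t. t) s = 1 / s\<^sup>2"
proof -
  have "laplace_transformable (\<lambda>_. 1)"
    by (rule laplace_transformable_bounded[of _ 1]) auto
  then have "(laplace (\<lambda>_. 1) has_real_derivative - laplace (\<lambda>t. t) s) (at s)"
    using laplace_has_real_derivative[of "\<lambda>_. 1" s] assms by simp
  then have "((\<lambda>s. 1 / s) has_real_derivative - laplace (\<lambda>t. t) s) (at s)"
    by (rule has_field_derivative_transform_within_open[of _ _ _ "{0<..}"])
      (use assms in \<open>auto simp: laplace_const\<close>)
  moreover have "((\<lambda>s. 1 / s) has_real_derivative - (1 / s\<^sup>2)) (at s)"
    using assms by (auto intro!: derivative_eq_intros simp: power2_eq_square)
  ultimately show ?thesis using DERIV_unique by fastforce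
qed

lemma tendsto_0_derivative_0_imp_0:
  fixes f :: "real \<Rightarrow> real"
  assumes deriv: "\<And>x. x > a \<Longrightarrow> (f has_real_derivative 0) (at x)"
    and lim: "(f \<longlongrightarrow> 0) at_top" and "x > a"
  shows "f x = 0"
proof -
  have "\<exists>c. \<forall>x\<in>{a<..}. f x = c"
    by (rule has_field_derivative_zero_constant) (auto intro: has_field_derivative_at_within deriv)
  then obtain c where c: "\<And>x. x > a \<Longrightarrow> f x = c" by auto
  have "\<forall>\<^sub>F x in at_top. f x = c" using eventually_gt_at_top[of a] by eventually_elim (rule c)
  then have "((\<lambda>_. c) \<longlongrightarrow> 0) (at_top :: real filter)" using lim tendsto_cong by fastforce
  then have "c = 0" by (simp add: tendsto_const_iff)
  then show ?thesis using c[OF \<open>x > a\<close>] by simp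
qed

text \<open>
  This is \<open>(1 / (2 * sinh t) - 1 / (2 * t)) / t\<close>.
\<close>

definition burnside_kernel :: "real \<Rightarrow> real" where
  "burnside_kernel t = (2 * t * exp t - exp (2*t) + 1) / (2 * t\<^sup>2 * (exp (2*t) - 1))"

lemma continuous_on_burnside_kernel: "continuous_on {0<..} burnside_kernel"
  unfolding burnside_kernel_def by (intro continuous_intros) auto

lemma burnside_kernel_at_0: "(burnside_kernel \<longlongrightarrow> - 1 / 12) (at_right 0)"
  unfolding burnside_kernel_def by real_asymp

lemma burnside_kernel_at_top: "(burnside_kernel \<longlongrightarrow> 0) at_top"
  unfolding burnside_kernel_def by real_asymp

lemma laplace_transformable_burnside_kernel: "laplace_transformable burnside_kernel"
  by (rule laplace_transformable_if_limits[OF continuous_on_burnside_kernel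
        burnside_kernel_at_0 burnside_kernel_at_top])

lemma laplace_tendsto_0:
  assumes "continuous_on {0<..} g" and "\<And>t. t > 0 \<Longrightarrow> \<bar>g t\<bar> \<le> C"
  shows "(laplace g \<longlongrightarrow> 0) at_top"
proof (rule Lim_null_comparison)
  show "\<forall>\<^sub>F s in at_top. norm (laplace g s) \<le> C / s"
    using eventually_gt_at_top[of 0] by eventually_elim (use abs_laplace_le[OF assms] in auto)
  show "((\<lambda>s. C / s) \<longlongrightarrow> 0) at_top" by real_asymp
qed

lemma laplace_burnside_kernel_at_top: "(laplace burnside_kernel \<longlongrightarrow> 0) at_top"
  using bounded_on_positive_reals[OF continuous_on_burnside_kernel burnside_kernel_at_0 burnside_kernel_at_top]
    laplace_tendsto_0[OF continuous_on_burnside_kernel] by metis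

lemma laplace_times_burnside_kernel_at_top: "(laplace (\<lambda>t. t * burnside_kernel t) \<longlongrightarrow> 0) at_top"
proof -
  have 1: "continuous_on {0<..} (\<lambda>t. t * burnside_kernel t)"
    by (intro continuous_intros continuous_on_burnside_kernel)
  have 2: "((\<lambda>t. t * burnside_kernel t) \<longlongrightarrow> 0) (at_right 0)"
    using tendsto_mult[OF tendsto_ident_at burnside_kernel_at_0] by simp
  have 3: "((\<lambda>t. t * burnside_kernel t) \<longlongrightarrow> 0) at_top"
    unfolding burnside_kernel_def by real_asymp
  show ?thesis
    using bounded_on_positive_reals[OF 1 2 3] laplace_tendsto_0[OF 1] by metis
qed

text \<open>
  In the difference the integrand acquires the factor \<open>exp (- 2 * t) - 1\<close>, which cancels the
  denominator \<open>exp (2 * t) - 1\<close> up to an exponential, while the factor \<open>t\<^sup>2\<close> cancels the other one.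
  What remains is a combination of \<open>1\<close>, \<open>exp (- 2 * t)\<close> and \<open>t * exp (- t)\<close>.
\<close>

lemma laplace_square_burnside_kernel_step:
  assumes s: "s > 0"
  shows "laplace (\<lambda>t. t * (t * burnside_kernel t)) (s + 2) - laplace (\<lambda>t. t * (t * burnside_kernel t)) s
    = 1 / (2 * s) - 1 / (2 * (s + 2)) - 1 / (s + 1)\<^sup>2"
proof -
  let ?k = "\<lambda>t. t * (t * burnside_kernel t)"
  have k: "laplace_transformable ?k"
    by (intro laplace_transformable_times laplace_transformable_burnside_kernel)
  have t: "laplace_transformable (\<lambda>t. t * 1)"
    by (intro laplace_transformable_times laplace_transformable_bounded[of _ 1]) auto
  have 1: "((\<lambda>t. ?k t * exp (- (s + 2) * t) - ?k t * exp (- s * t)) has_integral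
      laplace ?k (s + 2) - laplace ?k s) {0<..}"
    unfolding laplace_def using s
    by (intro has_integral_diff integrable_integral laplace_transformable_integrable k) auto
  have ident: "((\<lambda>t. t * exp (- (s + 1) * t)) has_integral 1 / (s + 1)\<^sup>2) {0<..}"
    using integrable_integral[OF laplace_transformable_integrable[OF t, of "s + 1"]]
      laplace_ident[of "s + 1"] s by (simp add: laplace_def)
  have "((\<lambda>t. 1/2 * exp (- s * t) - 1/2 * exp (- (s + 2) * t) - t * exp (- (s + 1) * t)) has_integral
      1/2 * (1 / s) - 1/2 * (1 / (s + 2)) - 1 / (s + 1)\<^sup>2) {0<..}"
    using s by (intro has_integral_diff has_integral_mult_right has_integral_exp_minus ident) auto
  moreover have "1/2 * exp (- s * t) - 1/2 * exp (- (s + 2) * t) - t * exp (- (s + 1) * t) =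
      ?k t * exp (- (s + 2) * t) - ?k t * exp (- s * t)" if "t \<in> {0<..}" for t
  proof -
    define E where "E = exp t"
    have E: "E > 1" using that by (simp add: E_def)
    then have E2: "E\<^sup>2 - 1 \<noteq> 0" by (simp add: power2_eq_1_iff)
    have "?k t = (2 * t * E - E\<^sup>2 + 1) / (2 * (E\<^sup>2 - 1))"
      using that exp_double[of t] by (simp add: burnside_kernel_def E_def power2_eq_square)
    then have k: "?k t * (E\<^sup>2 - 1) = (2 * t * E - E\<^sup>2 + 1) / 2" using E2 by (simp add: field_simps)
    have exps: "exp (- (s + 1) * t) = exp (- s * t) / E" "exp (- (s + 2) * t) = exp (- s * t) / E\<^sup>2"
      unfolding E_def by (simp_all add: exp_diff[symmetric] exp_double[symmetric] algebra_simps)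
    have "1/2 * exp (- s * t) - 1/2 * exp (- (s + 2) * t) - t * exp (- (s + 1) * t) =
        - exp (- s * t) * (?k t * (E\<^sup>2 - 1)) / E\<^sup>2"
      unfolding k exps using E by (simp add: divide_simps) (simp add: algebra_simps power2_eq_square)
    also have "\<dots> = ?k t * exp (- (s + 2) * t) - ?k t * exp (- s * t)"
      unfolding exps using E by (simp add: divide_simps) (simp add: algebra_simps)
    finally show ?thesis .
  qed
  ultimately have "((\<lambda>t. ?k t * exp (- (s + 2) * t) - ?k t * exp (- s * t)) has_integral
      1/2 * (1 / s) - 1/2 * (1 / (s + 2)) - 1 / (s + 1)\<^sup>2) {0<..}"
    by (rule has_integral_eq[rotated])
  from has_integral_unique[OF 1 this] show ?thesis by simp
qed

lemma burnside_b_step: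
  assumes "x > -1/2"
  shows "burnside_b (x + 1) - burnside_b x =
    ln (x + 1) - (x + 3/2) * ln (x + 3/2) + (x + 1/2) * ln (x + 1/2) + 1"
proof -
  have "Gamma (x + 1 + 1) = (x + 1) * Gamma (x + 1)"
    using assms by (intro Gamma_plus1) (auto elim!: nonpos_Ints_cases)
  moreover have "0 < Gamma (x + 1)" using assms by (intro Gamma_real_pos) simp
  then have "Gamma (x + 1) \<noteq> 0" by (rule less_imp_neq[symmetric])
  ultimately have "ln (Gamma (x + 1 + 1)) = ln (x + 1) + ln (Gamma (x + 1))"
    using assms by (simp add: ln_mult)
  moreover have "x + 1 + 1/2 = x + 3/2" by simp
  ultimately show ?thesis unfolding burnside_b_def by (simp add: algebra_simps)
qed

text \<open>
  For \<open>x > -1/2\<close> the gap is 0: it has period 1, as the increments of \<open>b\<close> show, is constant by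
  the limit formula for \<open>\<Gamma>\<close>, and vanishes by the duplication formula.
\<close>

definition burnside_gap :: "real \<Rightarrow> real" where
  "burnside_gap x = burnside_b x - laplace burnside_kernel (2 * x + 1)"

text \<open>
  The increment \<open>f x = burnside_gap (x + 1) - burnside_gap x\<close> has second derivative 0 by
  \<open>laplace_square_burnside_kernel_step\<close>.  Both \<open>f\<close> and \<open>f'\<close> tend to 0 at infinity, so first \<open>f'\<close> and then
  \<open>f\<close> vanishes.
\<close>

lemma burnside_gap_periodic:
  assumes x: "x > -1/2"
  shows "burnside_gap (x + 1) = burnside_gap x"
proof -
  let ?G = "laplace burnside_kernel"
  let ?G1 = "laplace (\<lambda>t. t * burnside_kernel t)"
  let ?G2 = "laplace (\<lambda>t. t * (t * burnside_kernel t))"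
  define f where "f x = ln (x + 1) - (x + 3/2) * ln (x + 3/2) + (x + 1/2) * ln (x + 1/2) + 1
      - (?G (2 * x + 3) - ?G (2 * x + 1))" for x :: real
  define f' where "f' x = 1 / (x + 1) - ln (x + 3/2) + ln (x + 1/2)
      + 2 * (?G1 (2 * x + 3) - ?G1 (2 * x + 1))" for x :: real
  note G = laplace_has_real_derivative[OF laplace_transformable_burnside_kernel]
  note G1 = laplace_has_real_derivative[OF laplace_transformable_times[OF laplace_transformable_burnside_kernel]]
  have f: "(f has_real_derivative f' x) (at x)" if x: "x > -1/2" for x
  proof -
    have ln: "((\<lambda>x. ln (x + 1)) has_real_derivative 1 / (x + 1)) (at x)"
      using x by (auto intro!: derivative_eq_intros)
    have x_ln: "((\<lambda>x. (x + a) * ln (x + a)) has_real_derivative ln (x + a) + 1) (at x)"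
      if "x + a > 0" for a
      using that by (auto intro!: derivative_eq_intros)
    have Gx: "((\<lambda>x. ?G (2 * x + a)) has_real_derivative - ?G1 (2 * x + a) * 2) (at x)"
      if "2 * x + a > 0" for a
      using G[OF that] by (rule DERIV_chain2[where g = "\<lambda>x. 2 * x + a"])
        (auto intro!: derivative_eq_intros)
    have "(f has_real_derivative 1 / (x + 1) - (ln (x + 3/2) + 1) + (ln (x + 1/2) + 1) + 0
        - (- ?G1 (2 * x + 3) * 2 - - ?G1 (2 * x + 1) * 2)) (at x)"
      unfolding f_def using x by (intro DERIV_add DERIV_diff DERIV_const ln x_ln Gx) simp_all
    then show ?thesis by (simp add: f'_def algebra_simps)
  qed
  have f'': "(f' has_real_derivative 0) (at x)" if x: "x > -1/2" for x
  proof -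
    have "(f' has_real_derivative - (1 / (x + 1)\<^sup>2) - 1 / (x + 3/2) + 1 / (x + 1/2)
        + 2 * (- ?G2 (2 * x + 3) * 2 - - ?G2 (2 * x + 1) * 2)) (at x)"
      unfolding f'_def using x
      by (auto intro!: derivative_eq_intros DERIV_chain2[OF G1] simp: power2_eq_square)
    moreover have "- (1 / (x + 1)\<^sup>2) - 1 / (x + 3/2) + 1 / (x + 1/2)
        + 2 * (- ?G2 (2 * x + 3) * 2 - - ?G2 (2 * x + 1) * 2) = 0"
    proof -
      have "(2 * x + 2)\<^sup>2 = 4 * (x + 1)\<^sup>2" by (simp add: power2_eq_square algebra_simps)
      moreover have "1 / (2 * (2 * x + 1)) = 1 / (x + 1/2) / 4" "1 / (2 * (2 * x + 3)) = 1 / (x + 3/2) / 4"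
        using x by (simp_all add: field_simps)
      ultimately have step: "?G2 (2 * x + 3) - ?G2 (2 * x + 1) =
          1 / (x + 1/2) / 4 - 1 / (x + 3/2) / 4 - 1 / (x + 1)\<^sup>2 / 4"
        using laplace_square_burnside_kernel_step[of "2 * x + 1"] x
        by (simp add: add.commute mult.commute)
      have "- w - v + u + 2 * (- p * 2 - - q * 2) = 0" if "p - q = u / 4 - v / 4 - w / 4" for p q u v w :: real
        using that by simp
      from this[OF step] show ?thesis .
    qed
    ultimately show ?thesis by simp
  qed
  have lin: "filterlim (\<lambda>x::real. 2 * x + 3) at_top at_top" "filterlim (\<lambda>x::real. 2 * x + 1) at_top at_top"
    by real_asymp+
  have "((\<lambda>x. (1 / (x + 1) - ln (x + 3/2) + ln (x + 1/2))
      + 2 * (?G1 (2 * x + 3) - ?G1 (2 * x + 1))) \<longlongrightarrow> 0 + 2 * (0 - 0)) at_top"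
  proof (intro tendsto_intros filterlim_compose[OF laplace_times_burnside_kernel_at_top] lin)
    show "((\<lambda>x::real. 1 / (x + 1) - ln (x + 3/2) + ln (x + 1/2)) \<longlongrightarrow> 0) at_top" by real_asymp
  qed
  then have "(f' \<longlongrightarrow> 0) at_top" unfolding f'_def by simp
  then have f'0: "f' x = 0" if "x > -1/2" for x
    using f'' that by (intro tendsto_0_derivative_0_imp_0[of "-1/2"])
  have "((\<lambda>x. (ln (x + 1) - (x + 3/2) * ln (x + 3/2) + (x + 1/2) * ln (x + 1/2) + 1)
      - (?G (2 * x + 3) - ?G (2 * x + 1))) \<longlongrightarrow> 0 - (0 - 0)) at_top"
  proof (intro tendsto_intros filterlim_compose[OF laplace_burnside_kernel_at_top] lin)
    show "((\<lambda>x::real. ln (x + 1) - (x + 3/2) * ln (x + 3/2) + (x + 1/2) * ln (x + 1/2) + 1) \<longlongrightarrow> 0) at_top"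
      by real_asymp
  qed
  then have "(f \<longlongrightarrow> 0) at_top" unfolding f_def by simp
  then have "f x = 0"
    using f f'0 x by (intro tendsto_0_derivative_0_imp_0[of "-1/2" f]) auto
  moreover have arg: "2 * (x + 1) + 1 = 2 * x + 3" by simp
  ultimately show ?thesis
    using burnside_b_step[OF x] unfolding burnside_gap_def f_def arg by linarith
qed

lemma burnside_gap_add_of_nat: "x > -1/2 \<Longrightarrow> burnside_gap (x + real n) = burnside_gap x"
proof (induction n)
  case (Suc n)
  then have "burnside_gap (x + real n + 1) = burnside_gap x"
    using burnside_gap_periodic[of "x + real n"] by simp
  then show ?case by (simp add: add_ac)
qed simp

lemma burnside_gap_minus_burnside_b: "((\<lambda>x. burnside_gap x - burnside_b x) \<longlongrightarrow> 0) at_top"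
proof -
  have "filterlim (\<lambda>x::real. 2 * x + 1) at_top at_top" by real_asymp
  then have "((\<lambda>x. - laplace burnside_kernel (2 * x + 1)) \<longlongrightarrow> - 0) at_top"
    by (intro tendsto_minus filterlim_compose[OF laplace_burnside_kernel_at_top])
  then show ?thesis by (simp add: burnside_gap_def)
qed

text \<open>
  The limit formula for \<open>\<Gamma>\<close> says that \<open>\<Gamma>(n + 1) * n powr x / \<Gamma>(x + n + 1)\<close> tends to 1.
\<close>

lemma burnside_b_shift_tendsto_0:
  assumes x: "x > -1/2"
  shows "(\<lambda>n. burnside_b (x + real n) - burnside_b (real n)) \<longlonglongrightarrow> 0"
proof -
  have pos: "Gamma (x + 1) > 0" using x by (intro Gamma_real_pos) simp
  have "(\<lambda>n. Gamma_series' (x + 1) n / Gamma (x + 1)) \<longlonglongrightarrow> Gamma (x + 1) / Gamma (x + 1)"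
    using pos by (intro tendsto_divide Gamma_series'_LIMSEQ tendsto_const) simp
  then have "(\<lambda>n. ln (Gamma_series' (x + 1) n / Gamma (x + 1))) \<longlonglongrightarrow> ln 1"
    using pos by (intro tendsto_ln) simp_all
  then have 1: "(\<lambda>n. - ln (Gamma_series' (x + 1) n / Gamma (x + 1))) \<longlonglongrightarrow> 0"
    using tendsto_minus by fastforce
  have 2: "(\<lambda>n. x * ln (real n) - (x + real n + 1/2) * ln (x + real n + 1/2) + x
      + (real n + 1/2) * ln (real n + 1/2)) \<longlonglongrightarrow> 0"
    by real_asymp
  have "\<forall>\<^sub>F n in sequentially.
      - ln (Gamma_series' (x + 1) n / Gamma (x + 1)) +
      (x * ln (real n) - (x + real n + 1/2) * ln (x + real n + 1/2) + x
        + (real n + 1/2) * ln (real n + 1/2)) = burnside_b (x + real n) - burnside_b (real n)"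
    using eventually_gt_at_top[of 0]
  proof eventually_elim
    fix n :: nat assume n: "n > 0"
    have pos': "Gamma (x + real n + 1) > 0" "Gamma (real n + 1) > 0"
      using x by (intro Gamma_real_pos; simp)+
    have "pochhammer (x + 1) n = Gamma (x + 1 + real n) / Gamma (x + 1)"
      using x by (intro pochhammer_Gamma) (auto elim!: nonpos_Ints_cases)
    moreover have "fact (n - 1) = Gamma (real n + 1) / n"
      using n Gamma_fact[of n, where ?'a = real] by (simp add: fact_reduce add.commute)
    moreover have "exp ((x + 1) * ln (real n)) = exp (x * ln (real n)) * n"
      using n by (simp add: distrib_right exp_add)
    ultimately have "Gamma_series' (x + 1) n / Gamma (x + 1) =
        Gamma (real n + 1) * exp (x * ln (real n)) / Gamma (x + real n + 1)"
      using n pos unfolding Gamma_series'_def by (simp add: add_ac)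
    then have "ln (Gamma_series' (x + 1) n / Gamma (x + 1)) =
        ln (Gamma (real n + 1)) + x * ln (real n) - ln (Gamma (x + real n + 1))"
      using pos'[THEN less_imp_neq] by (simp add: ln_div ln_mult)
    then show "- ln (Gamma_series' (x + 1) n / Gamma (x + 1)) +
      (x * ln (real n) - (x + real n + 1/2) * ln (x + real n + 1/2) + x
        + (real n + 1/2) * ln (real n + 1/2)) = burnside_b (x + real n) - burnside_b (real n)"
      unfolding burnside_b_def by simp
  qed
  then show ?thesis using tendsto_add[OF 1 2] tendsto_cong by fastforce
qed

text \<open>
  By periodicity the gap does not change under \<open>x \<mapsto> x + n\<close>.  As \<open>n\<close> grows the gap approaches \<open>b\<close>, and
  the values of \<open>b\<close> at \<open>x + n\<close> and at \<open>n\<close> approach each other.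
\<close>

lemma burnside_gap_const:
  assumes x: "x > -1/2"
  shows "burnside_gap x = burnside_gap 0"
proof -
  have real: "filterlim (\<lambda>n. y + real n) at_top sequentially" for y by real_asymp
  have "(\<lambda>n. (burnside_gap (x + real n) - burnside_b (x + real n))
      - (burnside_gap (0 + real n) - burnside_b (0 + real n))
      + (burnside_b (x + real n) - burnside_b (real n))) \<longlonglongrightarrow> 0 - 0 + 0"
    by (intro tendsto_add tendsto_diff burnside_b_shift_tendsto_0 x
        filterlim_compose[OF burnside_gap_minus_burnside_b real])
  then have "(\<lambda>n. burnside_gap x - burnside_gap 0) \<longlonglongrightarrow> 0"
    using burnside_gap_add_of_nat[OF x] burnside_gap_add_of_nat[of 0] by simp
  then show ?thesis by (simp add: LIMSEQ_const_iff)
qed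

lemma burnside_b_duplication:
  assumes x: "x > -1/2"
  shows "burnside_b x + burnside_b (x + 1/2) - burnside_b (2 * x + 1) =
    (2 * x + 3/2) * ln (2 * x + 3/2) - (x + 1/2) * ln (x + 1/2) - (x + 1) * ln (x + 1)
    - (2 * x + 3/2) * ln 2"
proof -
  have nonpos: "complex_of_real y \<notin> \<int>\<^sub>\<le>\<^sub>0" if "y > 0" for y
    using that by (auto elim!: nonpos_Ints_cases simp: complex_eq_iff)
  have "complex_of_real (Gamma (x + 1) * Gamma (x + 3/2)) =
      complex_of_real (exp (- (2 * x + 1) * ln 2) * sqrt pi * Gamma (2 * x + 2))"
    using Gamma_legendre_duplication[of "complex_of_real (x + 1)"] nonpos[of "x + 1"] nonpos[of "x + 3/2"] x
    by (simp add: Gamma_complex_of_real[symmetric] exp_of_real[symmetric] algebra_simps)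
  then have dup: "Gamma (x + 1) * Gamma (x + 3/2) = exp (- (2 * x + 1) * ln 2) * sqrt pi * Gamma (2 * x + 2)"
    unfolding of_real_eq_iff .
  have pos: "Gamma (x + 1) > 0" "Gamma (x + 3/2) > 0" "Gamma (2 * x + 2) > 0"
    using x by (auto intro!: Gamma_real_pos)
  have "ln (Gamma (x + 1)) + ln (Gamma (x + 3/2)) = ln (Gamma (x + 1) * Gamma (x + 3/2))"
    using pos by (simp add: ln_mult)
  also have "\<dots> = - (2 * x + 1) * ln 2 + 1/2 * ln pi + ln (Gamma (2 * x + 2))"
    unfolding dup using pos by (simp add: ln_mult ln_sqrt)
  finally have "ln (Gamma (x + 1)) + ln (Gamma (x + 3/2)) - ln (Gamma (2 * x + 2)) =
      - (2 * x + 1) * ln 2 + 1/2 * ln pi" by simp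
  moreover have "x + 1/2 + 1 = x + 3/2" "x + 1/2 + 1/2 = x + 1" "2 * x + 1 + 1 = 2 * x + 2"
    "2 * x + 1 + 1/2 = 2 * x + 3/2" by simp_all
  moreover have "ln (2 * pi) = ln 2 + ln pi" by (simp add: ln_mult)
  ultimately show ?thesis unfolding burnside_b_def by (simp add: algebra_simps)
qed

text \<open>
  If \<open>c\<close> is the constant gap, then \<open>b\<close> tends to \<open>c\<close>, so that \<open>b x + b (x + 1/2) - b (2 * x + 1)\<close> tends to
  \<open>c + c - c\<close>.  By the duplication formula it tends to 0.
\<close>

lemma burnside_b_eq_laplace:
  assumes x: "x > -1/2"
  shows "burnside_b x = laplace burnside_kernel (2 * x + 1)"
proof -
  let ?d = "\<lambda>x. burnside_gap x - burnside_b x"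
  have lims: "filterlim (\<lambda>x::real. x) at_top at_top" "filterlim (\<lambda>x::real. x + 1/2) at_top at_top"
    "filterlim (\<lambda>x::real. 2 * x + 1) at_top at_top" by real_asymp+
  have "((\<lambda>x. ((2 * x + 3/2) * ln (2 * x + 3/2) - (x + 1/2) * ln (x + 1/2) - (x + 1) * ln (x + 1)
    - (2 * x + 3/2) * ln 2) + (?d x + ?d (x + 1/2) - ?d (2 * x + 1))) \<longlongrightarrow> 0 + (0 + 0 - 0)) at_top"
  proof (intro tendsto_add tendsto_diff lims filterlim_compose[OF burnside_gap_minus_burnside_b])
    show "((\<lambda>x::real. (2 * x + 3/2) * ln (2 * x + 3/2) - (x + 1/2) * ln (x + 1/2) - (x + 1) * ln (x + 1)
      - (2 * x + 3/2) * ln 2) \<longlongrightarrow> 0) at_top"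
      by real_asymp
  qed
  moreover have "\<forall>\<^sub>F x in at_top. ((2 * x + 3/2) * ln (2 * x + 3/2) - (x + 1/2) * ln (x + 1/2)
    - (x + 1) * ln (x + 1) - (2 * x + 3/2) * ln 2) + (?d x + ?d (x + 1/2) - ?d (2 * x + 1)) = burnside_gap 0"
    using eventually_gt_at_top[of 0]
  proof eventually_elim
    fix x :: real assume "x > 0"
    then show "((2 * x + 3/2) * ln (2 * x + 3/2) - (x + 1/2) * ln (x + 1/2)
      - (x + 1) * ln (x + 1) - (2 * x + 3/2) * ln 2) + (?d x + ?d (x + 1/2) - ?d (2 * x + 1)) = burnside_gap 0"
      using burnside_b_duplication[of x] burnside_gap_const[of x] burnside_gap_const[of "x + 1/2"]
        burnside_gap_const[of "2 * x + 1"] by linarith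
  qed
  ultimately have "((\<lambda>x::real. burnside_gap 0) \<longlongrightarrow> 0) at_top"
    using tendsto_cong by fastforce
  then have "burnside_gap 0 = 0" by (simp add: tendsto_const_iff)
  then show ?thesis using burnside_gap_const[OF x] by (simp add: burnside_gap_def)
qed

section \<open>Successive derivatives of the kernel\<close>

definition kernel_quotient :: "nat \<Rightarrow> nat \<Rightarrow> (real \<Rightarrow> real) \<Rightarrow> real \<Rightarrow> real" where
  "kernel_quotient a b N t = N t / (t ^ a * (exp (2*t) - 1) ^ b)"

text \<open>
  The hypothesis \<open>eq\<close> is the conclusion after multiplication by the common denominator
  \<open>t ^ Suc a * (exp (2*t) - 1) ^ Suc b\<close>.
\<close>

lemma kernel_quotient_has_real_derivative:
  fixes N M :: "real \<Rightarrow> real"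
  assumes t: "t > 0" and N: "(N has_real_derivative N') (at t)"
    and eq: "N' * t * (exp (2*t) - 1) - N t * (of_nat a * (exp (2*t) - 1) + 2 * of_nat b * t * exp (2*t))
      = c * N t * t * (exp (2*t) - 1) + d * M t"
  shows "(kernel_quotient a b N has_real_derivative
    c * kernel_quotient a b N t + d * kernel_quotient (Suc a) (Suc b) M t) (at t)"
proof -
  define w where "w t = exp (2*t) - (1::real)" for t
  have w: "w t > 0" using t by (simp add: w_def)
  have dw: "(w has_real_derivative 2 * exp (2*t)) (at t)"
    unfolding w_def by (auto intro!: derivative_eq_intros)
  have pow: "((\<lambda>u. f u ^ n) has_real_derivative of_nat n * f t ^ n * f' / f t) (at t)"
    if "(f has_real_derivative f') (at t)" "f t > 0" for f :: "real \<Rightarrow> real" and f' n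
  proof -
    have "real n * (f' * f t ^ (n - Suc 0)) = real n * f t ^ n * f' / f t"
      using that(2) by (cases n) simp_all
    then show ?thesis using DERIV_power[OF that(1), of n] by simp
  qed
  have "((\<lambda>t. N t / (t ^ a * w t ^ b)) has_real_derivative
     (N' * (t ^ a * w t ^ b) - N t * (of_nat a * t ^ a * 1 / t * w t ^ b + of_nat b * w t ^ b * (2 * exp (2*t)) / w t * t ^ a))
       / ((t ^ a * w t ^ b) * (t ^ a * w t ^ b))) (at t)"
    using t w by (intro DERIV_divide DERIV_mult pow dw N DERIV_ident) auto
  also have "(N' * (t ^ a * w t ^ b) - N t * (of_nat a * t ^ a * 1 / t * w t ^ b + of_nat b * w t ^ b * (2 * exp (2*t)) / w t * t ^ a))
       / ((t ^ a * w t ^ b) * (t ^ a * w t ^ b)) =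
     (N' * t * w t - N t * (of_nat a * w t + 2 * of_nat b * t * exp (2*t))) / (t ^ Suc a * w t ^ Suc b)"
    using t w by (simp add: divide_simps) (simp add: algebra_simps)
  also have "N' * t * w t - N t * (of_nat a * w t + 2 * of_nat b * t * exp (2*t)) = c * N t * t * w t + d * M t"
    using eq by (simp add: w_def)
  also have "(c * N t * t * w t + d * M t) / (t ^ Suc a * w t ^ Suc b) =
      c * (N t / (t ^ a * w t ^ b)) + d * (M t / (t ^ Suc a * w t ^ Suc b))"
    using t w by (simp add: add_divide_distrib)
  finally show ?thesis unfolding w_def kernel_quotient_def[abs_def] .
qed

text \<open>
  Near 0 only the numerator needs to be expanded, since \<open>exp (2*t) - 1\<close> behaves like \<open>2 * t\<close>.
\<close>

lemma kernel_quotient_at_0: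
  fixes N :: "real \<Rightarrow> real"
  assumes "((\<lambda>t. N t / t ^ (a + b)) \<longlongrightarrow> c) (at_right 0)"
  shows "(kernel_quotient a b N \<longlongrightarrow> c / 2 ^ b) (at_right 0)"
proof -
  have "((\<lambda>t::real. t / (exp (2*t) - 1)) \<longlongrightarrow> 1 / 2) (at_right 0)" by real_asymp
  from tendsto_mult[OF assms tendsto_power[OF this, of b]]
  have lim: "((\<lambda>t. N t / t ^ (a + b) * (t / (exp (2*t) - 1)) ^ b) \<longlongrightarrow> c / 2 ^ b) (at_right 0)"
    by (simp add: power_divide)
  have "\<forall>\<^sub>F t in at_right 0. N t / t ^ (a + b) * (t / (exp (2*t) - 1)) ^ b
      = kernel_quotient a b N t"
    using eventually_at_right_less[of 0]
    by eventually_elim (simp add: kernel_quotient_def power_add power_divide)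
  from Lim_transform_eventually[OF lim this] show ?thesis .
qed

lemma continuous_on_kernel_quotient:
  "continuous_on {0<..} N \<Longrightarrow> continuous_on {0<..} (kernel_quotient a b N)"
  unfolding kernel_quotient_def[abs_def] by (intro continuous_intros) auto

lemma laplace_transformable_kernel_quotient:
  assumes "continuous_on {0<..} N" "((\<lambda>t. N t / t ^ (a + b)) \<longlongrightarrow> c) (at_right 0)"
    "(kernel_quotient a b N \<longlongrightarrow> 0) at_top"
  shows "laplace_transformable (kernel_quotient a b N)"
  by (rule laplace_transformable_if_limits[OF continuous_on_kernel_quotient[OF assms(1)]
      kernel_quotient_at_0[OF assms(2)] assms(3)])

lemma burnside_kernel_altdef: "burnside_kernel t = - 1/2 * kernel_quotient 2 1 f0 t"
proof -
  have "2 * t * exp t - exp (2*t) + 1 = - f0 t" by (simp add: f0_def)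
  then show ?thesis unfolding burnside_kernel_def kernel_quotient_def by simp
qed

text \<open>
  For exponential polynomials, \<open>kernel_quotient_has_real_derivative\<close> asks for an identity between
  polynomials in \<open>t\<close> and \<open>exp t\<close>, which the simplifier decides once the coefficient lists are known.
\<close>

lemma kernel_quotient_exp_poly_deriv:
  assumes "t > 0" and "a' = Suc a" "b' = Suc b"
    and "exp_poly (exp_poly_shift_deriv 0 P) t * t * (exp t ^ 2 - 1)
        - exp_poly P t * (of_nat a * (exp t ^ 2 - 1) + 2 * of_nat b * t * exp t ^ 2)
      = c * exp_poly P t * t * (exp t ^ 2 - 1) + d * exp_poly Q t"
  shows "(kernel_quotient a b (exp_poly P) has_real_derivative
    c * kernel_quotient a b (exp_poly P) t + d * kernel_quotient a' b' (exp_poly Q) t) (at t)"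
  unfolding assms(2,3)
  by (rule kernel_quotient_has_real_derivative[OF assms(1)])
    (use exp_poly_deriv[of P 0 t UNIV] assms(4) in \<open>simp_all add: exp_numeral_times\<close>)

text \<open>
  The numerators \<open>f1\<close>, \<open>f2\<close>, \<open>f3\<close> come from \<open>f0\<close> by repeated application of \<open>g \<mapsto> g - g'\<close>, the numerators
  \<open>h2\<close>, \<open>h3\<close>, \<open>h4\<close> by repeated application of \<open>g \<mapsto> g' + g\<close>, and \<open>h1\<close> is minus one half of the derivative.
\<close>

lemma kernel_quotient_f0_deriv_f1:
  assumes "t > 0"
  shows "(kernel_quotient 2 1 f0 has_real_derivative
    1 * kernel_quotient 2 1 f0 t + (- 1) * kernel_quotient 3 2 f1 t) (at t)"
  unfolding f0_eq_exp_poly f1_eq_exp_poly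
  by (rule kernel_quotient_exp_poly_deriv[OF assms])
    (simp_all add: f0_coeffs_def f1_coeffs_def algebra_simps power_numeral_reduce)

lemma kernel_quotient_f1_deriv_f2:
  assumes "t > 0"
  shows "(kernel_quotient 3 2 f1 has_real_derivative
    1 * kernel_quotient 3 2 f1 t + (- 1) * kernel_quotient 4 3 f2 t) (at t)"
  unfolding f1_eq_exp_poly f2_eq_exp_poly
  by (rule kernel_quotient_exp_poly_deriv[OF assms])
    (simp_all add: f1_coeffs_def f2_coeffs_def algebra_simps power_numeral_reduce)

lemma kernel_quotient_f2_deriv_f3:
  assumes "t > 0"
  shows "(kernel_quotient 4 3 f2 has_real_derivative
    1 * kernel_quotient 4 3 f2 t + (- 1) * kernel_quotient 5 4 f3 t) (at t)"
  unfolding f2_eq_exp_poly f3_eq_exp_poly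
  by (rule kernel_quotient_exp_poly_deriv[OF assms])
    (simp_all add: f2_coeffs_def f3_coeffs_def algebra_simps power_numeral_reduce)

lemma kernel_quotient_f0_deriv_h1:
  assumes "t > 0"
  shows "(kernel_quotient 2 1 f0 has_real_derivative
    0 * kernel_quotient 2 1 f0 t + (- 2) * kernel_quotient 3 2 h1 t) (at t)"
  unfolding f0_eq_exp_poly h1_eq_exp_poly
  by (rule kernel_quotient_exp_poly_deriv[OF assms])
    (simp_all add: f0_coeffs_def h1_coeffs_def algebra_simps power_numeral_reduce)

lemma kernel_quotient_f0_deriv_h2:
  assumes "t > 0"
  shows "(kernel_quotient 2 1 f0 has_real_derivative
    (- 1) * kernel_quotient 2 1 f0 t + 1 * kernel_quotient 3 2 h2 t) (at t)"
  unfolding f0_eq_exp_poly h2_eq_exp_poly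
  by (rule kernel_quotient_exp_poly_deriv[OF assms])
    (simp_all add: f0_coeffs_def h2_coeffs_def algebra_simps power_numeral_reduce)

lemma kernel_quotient_h2_deriv_h3:
  assumes "t > 0"
  shows "(kernel_quotient 3 2 h2 has_real_derivative
    (- 1) * kernel_quotient 3 2 h2 t + 1 * kernel_quotient 4 3 h3 t) (at t)"
  unfolding h2_eq_exp_poly h3_eq_exp_poly
  by (rule kernel_quotient_exp_poly_deriv[OF assms])
    (simp_all add: h2_coeffs_def h3_coeffs_def algebra_simps power_numeral_reduce)

lemma kernel_quotient_h3_deriv_h4:
  assumes "t > 0"
  shows "(kernel_quotient 4 3 h3 has_real_derivative
    (- 1) * kernel_quotient 4 3 h3 t + 1 * kernel_quotient 5 4 h4 t) (at t)"
  unfolding h3_eq_exp_poly h4_eq_exp_poly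
  by (rule kernel_quotient_exp_poly_deriv[OF assms])
    (simp_all add: h3_coeffs_def h4_coeffs_def algebra_simps power_numeral_reduce)

lemma continuous_on_exp_poly: "continuous_on S (exp_poly P)"
  by (rule DERIV_continuous_on[OF exp_poly_deriv[of P 0]])

lemma kernel_quotient_exp_poly_at_0_and_transformable:
  assumes "N = exp_poly P" "((\<lambda>t. N t / t ^ (a + b)) \<longlongrightarrow> c) (at_right 0)"
    "(kernel_quotient a b N \<longlongrightarrow> 0) at_top"
  shows "(kernel_quotient a b N \<longlongrightarrow> c / 2 ^ b) (at_right 0)"
    and "laplace_transformable (kernel_quotient a b N)"
  using kernel_quotient_at_0[OF assms(2)] laplace_transformable_kernel_quotient[OF _ assms(2,3)]
    continuous_on_exp_poly[of "{0<..}" P] assms(1) by simp_all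

lemma kernel_quotient_f0_at_top: "(kernel_quotient 2 1 f0 \<longlongrightarrow> 0) at_top"
  unfolding kernel_quotient_def[abs_def] f0_def by real_asymp

lemma f0_over_power_at_0: "((\<lambda>t. f0 t / t ^ (2 + 1)) \<longlongrightarrow> 1/3) (at_right 0)"
  unfolding f0_def by real_asymp

lemmas kernel_quotient_f0 = kernel_quotient_exp_poly_at_0_and_transformable[OF
    f0_eq_exp_poly f0_over_power_at_0 kernel_quotient_f0_at_top]

lemma kernel_quotient_f1_at_top: "(kernel_quotient 3 2 f1 \<longlongrightarrow> 0) at_top"
  unfolding kernel_quotient_def[abs_def] f1_def by real_asymp

lemma f1_over_power_at_0: "((\<lambda>t. f1 t / t ^ (3 + 2)) \<longlongrightarrow> 2/3) (at_right 0)"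
  unfolding f1_def by real_asymp

lemmas kernel_quotient_f1 = kernel_quotient_exp_poly_at_0_and_transformable[OF
    f1_eq_exp_poly f1_over_power_at_0 kernel_quotient_f1_at_top]

lemma kernel_quotient_f2_at_top: "(kernel_quotient 4 3 f2 \<longlongrightarrow> 0) at_top"
  unfolding kernel_quotient_def[abs_def] f2_def by real_asymp

lemma f2_over_power_at_0: "((\<lambda>t. f2 t / t ^ (4 + 3)) \<longlongrightarrow> 46/45) (at_right 0)"
  unfolding f2_def by real_asymp

lemmas kernel_quotient_f2 = kernel_quotient_exp_poly_at_0_and_transformable[OF
    f2_eq_exp_poly f2_over_power_at_0 kernel_quotient_f2_at_top]

lemma kernel_quotient_f3_at_top: "(kernel_quotient 5 4 f3 \<longlongrightarrow> 0) at_top"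
  unfolding kernel_quotient_def[abs_def] f3_def by real_asymp

lemma f3_over_power_at_0: "((\<lambda>t. f3 t / t ^ (5 + 4)) \<longlongrightarrow> 4/5) (at_right 0)"
  unfolding f3_def by real_asymp

lemmas kernel_quotient_f3 = kernel_quotient_exp_poly_at_0_and_transformable[OF
    f3_eq_exp_poly f3_over_power_at_0 kernel_quotient_f3_at_top]

lemma kernel_quotient_h1_at_top: "(kernel_quotient 3 2 h1 \<longlongrightarrow> 0) at_top"
  unfolding kernel_quotient_def[abs_def] h1_def by real_asymp

lemma h1_over_power_at_0: "((\<lambda>t. h1 t / t ^ (3 + 2)) \<longlongrightarrow> 0) (at_right 0)"
  unfolding h1_def by real_asymp

lemmas kernel_quotient_h1 = kernel_quotient_exp_poly_at_0_and_transformable[OF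
    h1_eq_exp_poly h1_over_power_at_0 kernel_quotient_h1_at_top]

lemma kernel_quotient_h2_at_top: "(kernel_quotient 3 2 h2 \<longlongrightarrow> 0) at_top"
  unfolding kernel_quotient_def[abs_def] h2_def by real_asymp

lemma h2_over_power_at_0: "((\<lambda>t. h2 t / t ^ (3 + 2)) \<longlongrightarrow> 2/3) (at_right 0)"
  unfolding h2_def by real_asymp

lemmas kernel_quotient_h2 = kernel_quotient_exp_poly_at_0_and_transformable[OF
    h2_eq_exp_poly h2_over_power_at_0 kernel_quotient_h2_at_top]

lemma kernel_quotient_h3_at_top: "(kernel_quotient 4 3 h3 \<longlongrightarrow> 0) at_top"
  unfolding kernel_quotient_def[abs_def] h3_def by real_asymp

lemma h3_over_power_at_0: "((\<lambda>t. h3 t / t ^ (4 + 3)) \<longlongrightarrow> 46/45) (at_right 0)"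
  unfolding h3_def by real_asymp

lemmas kernel_quotient_h3 = kernel_quotient_exp_poly_at_0_and_transformable[OF
    h3_eq_exp_poly h3_over_power_at_0 kernel_quotient_h3_at_top]

lemma kernel_quotient_h4_at_top: "(kernel_quotient 5 4 h4 \<longlongrightarrow> 0) at_top"
  unfolding kernel_quotient_def[abs_def] h4_def by real_asymp

lemma h4_over_power_at_0: "((\<lambda>t. h4 t / t ^ (5 + 4)) \<longlongrightarrow> 4/5) (at_right 0)"
  unfolding h4_def by real_asymp

lemmas kernel_quotient_h4 = kernel_quotient_exp_poly_at_0_and_transformable[OF
    h4_eq_exp_poly h4_over_power_at_0 kernel_quotient_h4_at_top]

section \<open>Powers of the variable times the remainder\<close>

lemma burnside_b_eq_laplace_quotient:
  assumes "x > -1/2"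
  shows "burnside_b x = - 1/2 * laplace (kernel_quotient 2 1 f0) (2 * x + 1)"
proof -
  have "laplace burnside_kernel s = - 1/2 * laplace (kernel_quotient 2 1 f0) s" for s
    unfolding laplace_def burnside_kernel_altdef mult.assoc by (rule integral_mult_right)
  then show ?thesis using burnside_b_eq_laplace[OF assms] by simp
qed

text \<open>
  The constants are the boundary values of the quotients, that is, the limits of \<open>f0 t / t ^ 3\<close>,
  \<open>f1 t / t ^ 5\<close>, ... divided by the powers of 2 that come from \<open>exp (2*t) - 1\<close>.
\<close>

lemma laplace_f0_minus:
  assumes "x > -1/2"
  shows "2 * x * laplace (kernel_quotient 2 1 f0) (2 * x + 1) =
    1/6 - laplace (kernel_quotient 3 2 f1) (2 * x + 1)"
  using laplace_shift[OF kernel_quotient_f0(2) kernel_quotient_f1(2)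
      kernel_quotient_f0_deriv_f1 kernel_quotient_f0(1) kernel_quotient_f0_at_top, of "2 * x + 1"] assms
  by simp

lemma laplace_f1_minus:
  assumes "x > -1/2"
  shows "2 * x * laplace (kernel_quotient 3 2 f1) (2 * x + 1) =
    1/6 - laplace (kernel_quotient 4 3 f2) (2 * x + 1)"
  using laplace_shift[OF kernel_quotient_f1(2) kernel_quotient_f2(2)
      kernel_quotient_f1_deriv_f2 kernel_quotient_f1(1) kernel_quotient_f1_at_top, of "2 * x + 1"] assms
  by simp

lemma laplace_f2_minus:
  assumes "x > -1/2"
  shows "2 * x * laplace (kernel_quotient 4 3 f2) (2 * x + 1) =
    23/180 - laplace (kernel_quotient 5 4 f3) (2 * x + 1)"
  using laplace_shift[OF kernel_quotient_f2(2) kernel_quotient_f3(2)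
      kernel_quotient_f2_deriv_f3 kernel_quotient_f2(1) kernel_quotient_f2_at_top, of "2 * x + 1"] assms
  by simp

lemma laplace_f0:
  assumes "x > -1/2"
  shows "(2 * x + 1) * laplace (kernel_quotient 2 1 f0) (2 * x + 1) =
    1/6 - 2 * laplace (kernel_quotient 3 2 h1) (2 * x + 1)"
  using laplace_shift[OF kernel_quotient_f0(2) kernel_quotient_h1(2)
      kernel_quotient_f0_deriv_h1 kernel_quotient_f0(1) kernel_quotient_f0_at_top, of "2 * x + 1"] assms
  by simp

lemma laplace_f0_plus:
  assumes "x > -1/2"
  shows "2 * (x + 1) * laplace (kernel_quotient 2 1 f0) (2 * x + 1) =
    1/6 + laplace (kernel_quotient 3 2 h2) (2 * x + 1)"
  using laplace_shift[OF kernel_quotient_f0(2) kernel_quotient_h2(2)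
      kernel_quotient_f0_deriv_h2 kernel_quotient_f0(1) kernel_quotient_f0_at_top, of "2 * x + 1"] assms
  by (simp add: algebra_simps)

lemma laplace_h2_plus:
  assumes "x > -1/2"
  shows "2 * (x + 1) * laplace (kernel_quotient 3 2 h2) (2 * x + 1) =
    1/6 + laplace (kernel_quotient 4 3 h3) (2 * x + 1)"
  using laplace_shift[OF kernel_quotient_h2(2) kernel_quotient_h3(2)
      kernel_quotient_h2_deriv_h3 kernel_quotient_h2(1) kernel_quotient_h2_at_top, of "2 * x + 1"] assms
  by (simp add: algebra_simps)

lemma laplace_h3_plus:
  assumes "x > -1/2"
  shows "2 * (x + 1) * laplace (kernel_quotient 4 3 h3) (2 * x + 1) =
    23/180 + laplace (kernel_quotient 5 4 h4) (2 * x + 1)"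
  using laplace_shift[OF kernel_quotient_h3(2) kernel_quotient_h4(2)
      kernel_quotient_h3_deriv_h4 kernel_quotient_h3(1) kernel_quotient_h3_at_top, of "2 * x + 1"] assms
  by (simp add: algebra_simps)

lemma laplace_kernel_quotient:
  "laplace (kernel_quotient a b N) s =
    integral {0<..} (\<lambda>t. N t / (t ^ a * (exp (2*t) - 1) ^ b) * exp (- s * t))"
  by (simp add: laplace_def kernel_quotient_def)

text \<open>
  A formula for \<open>F\<close> as a multiple of the transform of a quotient with absolutely monotonic numerator
  yields the integral representation and complete monotonicity together.
\<close>

lemma laplace_kernel_quotient_representation:
  assumes transformable: "laplace_transformable (kernel_quotient a b N)"
    and N: "absolutely_monotonic_on {0<..} N" and c: "c \<ge> 0"
    and F: "\<And>x. x > -1/2 \<Longrightarrow> F x = c * laplace (kernel_quotient a b N) (2 * x + 1)"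
  shows "x > -1/2 \<Longrightarrow>
      (\<lambda>t. N t / (t ^ a * (exp (2*t) - 1) ^ b) * exp (- (2*x + 1) * t)) integrable_on {0<..}"
    and "x > -1/2 \<Longrightarrow>
      F x = c * integral {0<..} (\<lambda>t. N t / (t ^ a * (exp (2*t) - 1) ^ b) * exp (- (2*x + 1) * t))"
    and "l \<ge> -1/2 \<Longrightarrow> completely_monotonic_on {l<..} F"
proof -
  show "(\<lambda>t. N t / (t ^ a * (exp (2*t) - 1) ^ b) * exp (- (2*x + 1) * t)) integrable_on {0<..}"
    if "x > -1/2"
    using laplace_transformable_integrable[OF transformable, of "2 * x + 1"] that
    by (simp add: kernel_quotient_def)
  show "F x = c * integral {0<..} (\<lambda>t. N t / (t ^ a * (exp (2*t) - 1) ^ b) * exp (- (2*x + 1) * t))"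
    if "x > -1/2"
    using F[OF that] unfolding laplace_kernel_quotient .
  show "completely_monotonic_on {l<..} F" if l: "l \<ge> -1/2"
  proof (rule completely_monotonic_on_laplace[OF transformable _ _ c])
    show "kernel_quotient a b N t \<ge> 0" if "t > 0" for t
      using absolutely_monotonic_on_imp_nonneg[OF N, of t] that by (simp add: kernel_quotient_def)
    show "F x = c * laplace (kernel_quotient a b N) (2 * x + 1)" if "x \<in> {l<..}" for x
      using that l by (intro F) simp
  qed (use l in auto)
qed

lemma burnside_b_integrand:
  assumes "t > 0"
  shows "(1 - exp t / (2*t) + 1 / (exp (2*t) - 1)) * (1/t) * exp (- 2 * (x + 1) * t) =
    - 1/2 * (kernel_quotient 2 1 f0 t * exp (- (2 * x + 1) * t))"
proof -
  define E where "E = exp t"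
  have E: "E > 1" using assms by (simp add: E_def)
  then have E2: "E\<^sup>2 \<noteq> 1" by (simp add: power2_eq_1_iff)
  have e1: "exp (- 2 * (x + 1) * t) = exp (- (2 * x + 1) * t) / E"
    unfolding E_def by (simp add: exp_diff[symmetric] algebra_simps)
  have e2: "(1 - E / (2*t) + 1 / (E\<^sup>2 - 1)) * (1/t) / E = - 1/2 * ((E\<^sup>2 - 2 * t * E - 1) / (t\<^sup>2 * (E\<^sup>2 - 1)))"
    using assms E E2 by (simp add: divide_simps) (simp add: algebra_simps power2_eq_square)
  have "(1 - E / (2*t) + 1 / (E\<^sup>2 - 1)) * (1/t) * exp (- 2 * (x + 1) * t) =
      (1 - E / (2*t) + 1 / (E\<^sup>2 - 1)) * (1/t) / E * exp (- (2 * x + 1) * t)"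
    unfolding e1 by simp
  also have "\<dots> = - 1/2 * ((E\<^sup>2 - 2 * t * E - 1) / (t\<^sup>2 * (E\<^sup>2 - 1)) * exp (- (2 * x + 1) * t))"
    unfolding e2 by (simp only: mult.assoc)
  finally show ?thesis
    unfolding kernel_quotient_def f0_def E_def exp_numeral_times power_one_right .
qed

lemma burnside_b_laplace:
  "((\<forall>x. x > -1/2 \<longrightarrow>
        (\<lambda>t. (1 - exp t / (2*t) + 1 / (exp (2*t) - 1)) * (1/t) * exp (- 2 * (x + 1) * t)) integrable_on {0<..} \<and>
        (x \<noteq> 0 \<longrightarrow> burnside_b x = burnside_w x / (12 * x)) \<and>
        burnside_b x = integral {0<..} (\<lambda>t. (1 - exp t / (2*t) + 1 / (exp (2*t) - 1)) * (1/t) * exp (- 2 * (x + 1) * t))) \<and>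
     completely_monotonic_on {-1/2<..} (\<lambda>x. - burnside_b x))"
proof (intro conjI allI impI)
  fix x :: real assume x: "x > -1/2"
  let ?f = "\<lambda>t. (1 - exp t / (2*t) + 1 / (exp (2*t) - 1)) * (1/t) * exp (- 2 * (x + 1) * t)"
  have "((\<lambda>t. - 1/2 * (kernel_quotient 2 1 f0 t * exp (- (2 * x + 1) * t))) has_integral burnside_b x) {0<..}"
    unfolding burnside_b_eq_laplace_quotient[OF x] laplace_def using x
    by (intro has_integral_mult_right integrable_integral laplace_transformable_integrable kernel_quotient_f0) simp
  then have "(?f has_integral burnside_b x) {0<..}"
    by (rule has_integral_eq[rotated]) (rule burnside_b_integrand[symmetric], simp)
  then show "?f integrable_on {0<..}" "burnside_b x = integral {0<..} ?f"
    by (auto simp: integral_unique)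
  show "burnside_b x = burnside_w x / (12 * x)" if "x \<noteq> 0"
    using that by (simp add: burnside_w_def)
next
  show "completely_monotonic_on {-1/2<..} (\<lambda>x. - burnside_b x)"
    by (rule laplace_kernel_quotient_representation(3)[OF kernel_quotient_f0(2)
          absolutely_monotonic_f0, of "1/2"]) (simp_all add: burnside_b_eq_laplace_quotient)
qed

lemma burnside_b_times_x:
  "((\<forall>x. x > 0 \<longrightarrow>
        (\<lambda>t. f1 t / (t^3 * (exp (2*t) - 1)^2) * exp (- (2*x + 1) * t)) integrable_on {0<..} \<and>
        x * burnside_b x + 1/24 = 1/12 * (burnside_w x + 1/2) \<and>
        x * burnside_b x + 1/24 = 1/4 * integral {0<..} (\<lambda>t. f1 t / (t^3 * (exp (2*t) - 1)^2) * exp (- (2*x + 1) * t))) \<and>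
     completely_monotonic_on {0<..} (\<lambda>x. x * burnside_b x + 1/24) \<and>
     absolutely_monotonic_on {0<..} f1)"
proof -
  have eq: "x * burnside_b x + 1/24 =
      1/4 * laplace (kernel_quotient 3 2 f1) (2 * x + 1)" if x: "x > -1/2" for x
    using laplace_f0_minus[OF x]
    unfolding burnside_b_eq_laplace_quotient[OF x] by algebra
  have w: "x * burnside_b x + 1/24 = 1/12 * (burnside_w x + 1/2)" for x
    by (simp add: burnside_w_def algebra_simps power2_eq_square power3_eq_cube)
  note rep = laplace_kernel_quotient_representation[OF kernel_quotient_f1(2) absolutely_monotonic_f1 _ eq]
  show ?thesis
    by (intro conjI allI impI w rep absolutely_monotonic_f1) simp_all
qed

lemma burnside_b_times_x_squared:
  "((\<forall>x. x > 0 \<longrightarrow>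
        (\<lambda>t. f2 t / (t^4 * (exp (2*t) - 1)^3) * exp (- (2*x + 1) * t)) integrable_on {0<..} \<and>
        1/6 - x/3 - 8 * x^2 * burnside_b x = 2/3 * (1/4 - x/2 - x * burnside_w x) \<and>
        1/6 - x/3 - 8 * x^2 * burnside_b x = integral {0<..} (\<lambda>t. f2 t / (t^4 * (exp (2*t) - 1)^3) * exp (- (2*x + 1) * t))) \<and>
     completely_monotonic_on {0<..} (\<lambda>x. 1/6 - x/3 - 8 * x^2 * burnside_b x) \<and>
     absolutely_monotonic_on {0<..} f2)"
proof -
  have eq: "1/6 - x/3 - 8 * x^2 * burnside_b x =
      1 * laplace (kernel_quotient 4 3 f2) (2 * x + 1)" if x: "x > -1/2" for x
    using laplace_f0_minus[OF x] laplace_f1_minus[OF x]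
    unfolding burnside_b_eq_laplace_quotient[OF x] by algebra
  have w: "1/6 - x/3 - 8 * x^2 * burnside_b x = 2/3 * (1/4 - x/2 - x * burnside_w x)" for x
    by (simp add: burnside_w_def algebra_simps power2_eq_square power3_eq_cube)
  note rep = laplace_kernel_quotient_representation[OF kernel_quotient_f2(2) absolutely_monotonic_f2 _ eq, unfolded mult_1_left]
  show ?thesis
    by (intro conjI allI impI w rep absolutely_monotonic_f2) simp_all
qed

lemma burnside_b_times_x_cubed:
  "((\<forall>x. x > 0 \<longrightarrow>
        (\<lambda>t. f3 t / (t^5 * (exp (2*t) - 1)^4) * exp (- (2*x + 1) * t)) integrable_on {0<..} \<and>
        16 * x^3 * burnside_b x + 2/3 * x^2 - 1/3 * x + 23/180 = 4/3 * (x^2 * burnside_w x + 1/2 * x^2 - 1/4 * x + 23/240) \<and>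
        16 * x^3 * burnside_b x + 2/3 * x^2 - 1/3 * x + 23/180 = integral {0<..} (\<lambda>t. f3 t / (t^5 * (exp (2*t) - 1)^4) * exp (- (2*x + 1) * t))) \<and>
     completely_monotonic_on {0<..} (\<lambda>x. 16 * x^3 * burnside_b x + 2/3 * x^2 - 1/3 * x + 23/180) \<and>
     absolutely_monotonic_on {0<..} f3)"
proof -
  have eq: "16 * x^3 * burnside_b x + 2/3 * x^2 - 1/3 * x + 23/180 =
      1 * laplace (kernel_quotient 5 4 f3) (2 * x + 1)" if x: "x > -1/2" for x
    using laplace_f0_minus[OF x] laplace_f1_minus[OF x] laplace_f2_minus[OF x]
    unfolding burnside_b_eq_laplace_quotient[OF x] by algebra
  have w: "16 * x^3 * burnside_b x + 2/3 * x^2 - 1/3 * x + 23/180 =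
      4/3 * (x^2 * burnside_w x + 1/2 * x^2 - 1/4 * x + 23/240)" for x
    by (simp add: burnside_w_def algebra_simps power2_eq_square power3_eq_cube)
  note rep = laplace_kernel_quotient_representation[OF kernel_quotient_f3(2) absolutely_monotonic_f3 _ eq, unfolded mult_1_left]
  show ?thesis
    by (intro conjI allI impI w rep absolutely_monotonic_f3) simp_all
qed

lemma burnside_b_times_2x_plus_1:
  "((\<forall>x. x > -1/2 \<longrightarrow>
        (\<lambda>t. h1 t / ((exp (2*t) - 1)^2 * t^3) * exp (- (2*x + 1) * t)) integrable_on {0<..} \<and>
        (2*x + 1) * burnside_b x + 1/12 = integral {0<..} (\<lambda>t. h1 t / ((exp (2*t) - 1)^2 * t^3) * exp (- (2*x + 1) * t))) \<and>
     completely_monotonic_on {-1/2<..} (\<lambda>x. (2*x + 1) * burnside_b x + 1/12) \<and>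
     absolutely_monotonic_on {0<..} h1)"
proof -
  have eq: "(2*x + 1) * burnside_b x + 1/12 =
      1 * laplace (kernel_quotient 3 2 h1) (2 * x + 1)" if x: "x > -1/2" for x
    using laplace_f0[OF x]
    unfolding burnside_b_eq_laplace_quotient[OF x] by algebra
  note rep = laplace_kernel_quotient_representation[OF kernel_quotient_h1(2) absolutely_monotonic_h1 _ eq, unfolded mult_1_left]
  show ?thesis
    unfolding mult.commute[of "(exp (2 * t) - 1) ^ b" "t ^ a" for a b and t :: real]
    by (intro conjI allI impI rep absolutely_monotonic_h1) simp_all
qed

lemma burnside_b_times_x_plus_1:
  "((\<forall>x. x > -1/2 \<longrightarrow>
        (\<lambda>t. h2 t / (t^3 * (exp (2*t) - 1)^2) * exp (- (2*x + 1) * t)) integrable_on {0<..} \<and>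
        - ((x + 1) * burnside_b x) - 1/24 = 1/4 * integral {0<..} (\<lambda>t. h2 t / (t^3 * (exp (2*t) - 1)^2) * exp (- (2*x + 1) * t))) \<and>
     completely_monotonic_on {-1/2<..} (\<lambda>x. - ((x + 1) * burnside_b x) - 1/24) \<and>
     absolutely_monotonic_on {0<..} h2)"
proof -
  have eq: "- ((x + 1) * burnside_b x) - 1/24 =
      1/4 * laplace (kernel_quotient 3 2 h2) (2 * x + 1)" if x: "x > -1/2" for x
    using laplace_f0_plus[OF x]
    unfolding burnside_b_eq_laplace_quotient[OF x] by algebra
  note rep = laplace_kernel_quotient_representation[OF kernel_quotient_h2(2) absolutely_monotonic_h2 _ eq]
  show ?thesis
    by (intro conjI allI impI rep absolutely_monotonic_h2) simp_all
qed

lemma burnside_b_times_x_plus_1_squared: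
  "((\<forall>x. x > -1/2 \<longrightarrow>
        (\<lambda>t. h3 t / ((exp (2*t) - 1)^3 * t^4) * exp (- (2*x + 1) * t)) integrable_on {0<..} \<and>
        - ((x + 1)^2 * burnside_b x) - 1/24 * x - 1/16 = 1/8 * integral {0<..} (\<lambda>t. h3 t / ((exp (2*t) - 1)^3 * t^4) * exp (- (2*x + 1) * t))) \<and>
     completely_monotonic_on {-1/2<..} (\<lambda>x. - ((x + 1)^2 * burnside_b x) - 1/24 * x - 1/16) \<and>
     absolutely_monotonic_on {0<..} h3)"
proof -
  have eq: "- ((x + 1)^2 * burnside_b x) - 1/24 * x - 1/16 =
      1/8 * laplace (kernel_quotient 4 3 h3) (2 * x + 1)" if x: "x > -1/2" for x
    using laplace_f0_plus[OF x] laplace_h2_plus[OF x]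
    unfolding burnside_b_eq_laplace_quotient[OF x] by algebra
  note rep = laplace_kernel_quotient_representation[OF kernel_quotient_h3(2) absolutely_monotonic_h3 _ eq]
  show ?thesis
    unfolding mult.commute[of "(exp (2 * t) - 1) ^ b" "t ^ a" for a b and t :: real]
    by (intro conjI allI impI rep absolutely_monotonic_h3) simp_all
qed

lemma burnside_b_times_x_plus_1_cubed:
  "((\<forall>x. x > -1/2 \<longrightarrow>
        (\<lambda>t. h4 t / ((exp (2*t) - 1)^4 * t^5) * exp (- (2*x + 1) * t)) integrable_on {0<..} \<and>
        - ((x + 1)^3 * burnside_b x) - x^2/24 - 5 * x/48 - 203/2880 = 1/16 * integral {0<..} (\<lambda>t. h4 t / ((exp (2*t) - 1)^4 * t^5) * exp (- (2*x + 1) * t))) \<and>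
     completely_monotonic_on {-1/2<..} (\<lambda>x. - ((x + 1)^3 * burnside_b x) - x^2/24 - 5 * x/48 - 203/2880) \<and>
     absolutely_monotonic_on {0<..} h4)"
proof -
  have eq: "- ((x + 1)^3 * burnside_b x) - x^2/24 - 5 * x/48 - 203/2880 =
      1/16 * laplace (kernel_quotient 5 4 h4) (2 * x + 1)" if x: "x > -1/2" for x
    using laplace_f0_plus[OF x] laplace_h2_plus[OF x] laplace_h3_plus[OF x]
    unfolding burnside_b_eq_laplace_quotient[OF x] by algebra
  note rep = laplace_kernel_quotient_representation[OF kernel_quotient_h4(2) absolutely_monotonic_h4 _ eq]
  show ?thesis
    unfolding mult.commute[of "(exp (2 * t) - 1) ^ b" "t ^ a" for a b and t :: real]
    by (intro conjI allI impI rep absolutely_monotonic_h4) simp_all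
qed

theorem theorem1p1:
  shows "
    ((\<forall>x. x > -1/2 \<longrightarrow>
        (\<lambda>t. (1 - exp t / (2*t) + 1 / (exp (2*t) - 1)) * (1/t) * exp (- 2 * (x + 1) * t)) integrable_on {0<..} \<and>
        (x \<noteq> 0 \<longrightarrow> burnside_b x = burnside_w x / (12 * x)) \<and>
        burnside_b x = integral {0<..} (\<lambda>t. (1 - exp t / (2*t) + 1 / (exp (2*t) - 1)) * (1/t) * exp (- 2 * (x + 1) * t))) \<and>
     completely_monotonic_on {-1/2<..} (\<lambda>x. - burnside_b x)) \<and>
    ((\<forall>x. x > 0 \<longrightarrow>
        (\<lambda>t. f1 t / (t^3 * (exp (2*t) - 1)^2) * exp (- (2*x + 1) * t)) integrable_on {0<..} \<and>
        x * burnside_b x + 1/24 = 1/12 * (burnside_w x + 1/2) \<and>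
        x * burnside_b x + 1/24 = 1/4 * integral {0<..} (\<lambda>t. f1 t / (t^3 * (exp (2*t) - 1)^2) * exp (- (2*x + 1) * t))) \<and>
     completely_monotonic_on {0<..} (\<lambda>x. x * burnside_b x + 1/24) \<and>
     absolutely_monotonic_on {0<..} f1) \<and>
    ((\<forall>x. x > 0 \<longrightarrow>
        (\<lambda>t. f2 t / (t^4 * (exp (2*t) - 1)^3) * exp (- (2*x + 1) * t)) integrable_on {0<..} \<and>
        1/6 - x/3 - 8 * x^2 * burnside_b x = 2/3 * (1/4 - x/2 - x * burnside_w x) \<and>
        1/6 - x/3 - 8 * x^2 * burnside_b x = integral {0<..} (\<lambda>t. f2 t / (t^4 * (exp (2*t) - 1)^3) * exp (- (2*x + 1) * t))) \<and>
     completely_monotonic_on {0<..} (\<lambda>x. 1/6 - x/3 - 8 * x^2 * burnside_b x) \<and>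
     absolutely_monotonic_on {0<..} f2) \<and>
    ((\<forall>x. x > 0 \<longrightarrow>
        (\<lambda>t. f3 t / (t^5 * (exp (2*t) - 1)^4) * exp (- (2*x + 1) * t)) integrable_on {0<..} \<and>
        16 * x^3 * burnside_b x + 2/3 * x^2 - 1/3 * x + 23/180 = 4/3 * (x^2 * burnside_w x + 1/2 * x^2 - 1/4 * x + 23/240) \<and>
        16 * x^3 * burnside_b x + 2/3 * x^2 - 1/3 * x + 23/180 = integral {0<..} (\<lambda>t. f3 t / (t^5 * (exp (2*t) - 1)^4) * exp (- (2*x + 1) * t))) \<and>
     completely_monotonic_on {0<..} (\<lambda>x. 16 * x^3 * burnside_b x + 2/3 * x^2 - 1/3 * x + 23/180) \<and>
     absolutely_monotonic_on {0<..} f3) \<and>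
    ((\<forall>x. x > -1/2 \<longrightarrow>
        (\<lambda>t. h1 t / ((exp (2*t) - 1)^2 * t^3) * exp (- (2*x + 1) * t)) integrable_on {0<..} \<and>
        (2*x + 1) * burnside_b x + 1/12 = integral {0<..} (\<lambda>t. h1 t / ((exp (2*t) - 1)^2 * t^3) * exp (- (2*x + 1) * t))) \<and>
     completely_monotonic_on {-1/2<..} (\<lambda>x. (2*x + 1) * burnside_b x + 1/12) \<and>
     absolutely_monotonic_on {0<..} h1) \<and>
    ((\<forall>x. x > -1/2 \<longrightarrow>
        (\<lambda>t. h2 t / (t^3 * (exp (2*t) - 1)^2) * exp (- (2*x + 1) * t)) integrable_on {0<..} \<and>
        - ((x + 1) * burnside_b x) - 1/24 = 1/4 * integral {0<..} (\<lambda>t. h2 t / (t^3 * (exp (2*t) - 1)^2) * exp (- (2*x + 1) * t))) \<and>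
     completely_monotonic_on {-1/2<..} (\<lambda>x. - ((x + 1) * burnside_b x) - 1/24) \<and>
     absolutely_monotonic_on {0<..} h2) \<and>
    ((\<forall>x. x > -1/2 \<longrightarrow>
        (\<lambda>t. h3 t / ((exp (2*t) - 1)^3 * t^4) * exp (- (2*x + 1) * t)) integrable_on {0<..} \<and>
        - ((x + 1)^2 * burnside_b x) - 1/24 * x - 1/16 = 1/8 * integral {0<..} (\<lambda>t. h3 t / ((exp (2*t) - 1)^3 * t^4) * exp (- (2*x + 1) * t))) \<and>
     completely_monotonic_on {-1/2<..} (\<lambda>x. - ((x + 1)^2 * burnside_b x) - 1/24 * x - 1/16) \<and>
     absolutely_monotonic_on {0<..} h3) \<and>
    ((\<forall>x. x > -1/2 \<longrightarrow>
        (\<lambda>t. h4 t / ((exp (2*t) - 1)^4 * t^5) * exp (- (2*x + 1) * t)) integrable_on {0<..} \<and>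
        - ((x + 1)^3 * burnside_b x) - x^2/24 - 5 * x/48 - 203/2880 = 1/16 * integral {0<..} (\<lambda>t. h4 t / ((exp (2*t) - 1)^4 * t^5) * exp (- (2*x + 1) * t))) \<and>
     completely_monotonic_on {-1/2<..} (\<lambda>x. - ((x + 1)^3 * burnside_b x) - x^2/24 - 5 * x/48 - 203/2880) \<and>
     absolutely_monotonic_on {0<..} h4)"
  by (rule conjI[OF burnside_b_laplace
    conjI[OF burnside_b_times_x
    conjI[OF burnside_b_times_x_squared
    conjI[OF burnside_b_times_x_cubed
    conjI[OF burnside_b_times_2x_plus_1
    conjI[OF burnside_b_times_x_plus_1
    conjI[OF burnside_b_times_x_plus_1_squared
    burnside_b_times_x_plus_1_cubed]]]]]]])

end
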